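(* For any triangle-free graph $G$, $\beta(G)\leq \frac{27}{1024}$.
   Context: All graphs are finite and simple. For a graph $G$ with $n\geq 1$ vertices, a half in $G$ is a function $\mu: V(G)\to[0,1]$ such that $\sum_{v\in V(G)}\mu(v)=n/2$. Put $\beta(G,\mu)=\frac1{n^2}\sum_{\{u,v\}\in E(G)}\mu(u)\mu(v)$ (each edge is counted once) and $\beta(G)=\min\{\beta(G,\mu): \mu \text{ is a half in } G\}$. *)

theory Defs
  imports "HOL-Analysis.Analysis"
begin

definition simple_graph :: "'a set \<Rightarrow> 'a set set \<Rightarrow> bool" where
  "simple_graph V E \<longleftrightarrow> finite V \<and> (\<forall>e\<in>E. e \<subseteq> V \<and> card e = 2)"

text \<open>The three vertices below are automatically distinct, since edges have cardinality 2.\<close>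

definition triangle_free :: "'a set set \<Rightarrow> bool" where
  "triangle_free E \<longleftrightarrow> \<not> (\<exists>u v w. {u, v} \<in> E \<and> {v, w} \<in> E \<and> {u, w} \<in> E)"

definition halves :: "'a set \<Rightarrow> ('a \<Rightarrow> real) set" where
  "halves V = {\<mu>. \<mu> \<in> V \<rightarrow>\<^sub>E {0..1} \<and> (\<Sum>v\<in>V. \<mu> v) = real (card V) / 2}"

definition beta_half :: "'a set \<Rightarrow> 'a set set \<Rightarrow> ('a \<Rightarrow> real) \<Rightarrow> real" where
  "beta_half V E \<mu> = (\<Sum>e\<in>E. \<Prod>v\<in>e. \<mu> v) / (real (card V))\<^sup>2"

text \<open>The minimum over all halves, as a least element; it exists by lemma \<open>beta_attained\<close>.\<close>

definition beta :: "'a set \<Rightarrow> 'a set set \<Rightarrow> real" where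
  "beta V E = (LEAST b. b \<in> beta_half V E ` halves V)"

lemma compact_halves:
  assumes "finite V"
  shows "compact (halves V)"
proof -
  define S :: "'a \<Rightarrow> real set" where "S = (\<lambda>v. if v \<in> V then {0..1} else {undefined})"
  have "compactin (product_topology (\<lambda>_. euclidean) UNIV) (Pi\<^sub>E UNIV S)"
    unfolding compactin_PiE by (auto simp: S_def)
  then have c: "compact (Pi\<^sub>E UNIV S)"
    by (simp add: euclidean_product_topology)
  have "continuous_on UNIV (\<lambda>\<mu>::'a \<Rightarrow> real. \<Sum>v\<in>V. \<mu> v)"
    by (intro continuous_intros continuous_on_product_coordinates)
  then have cl: "closed ((\<lambda>\<mu>::'a \<Rightarrow> real. \<Sum>v\<in>V. \<mu> v) -` {real (card V) / 2})"
    by (intro closed_vimage) auto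
  have "halves V = Pi\<^sub>E UNIV S \<inter> (\<lambda>\<mu>. \<Sum>v\<in>V. \<mu> v) -` {real (card V) / 2}"
    by (auto simp: halves_def S_def PiE_def Pi_def extensional_def split: if_splits)
  with compact_Int_closed[OF c cl] show ?thesis by simp
qed

lemma beta_attained:
  assumes "simple_graph V E"
  shows "\<exists>\<mu>\<in>halves V. beta V E = beta_half V E \<mu> \<and> (\<forall>\<nu>\<in>halves V. beta_half V E \<mu> \<le> beta_half V E \<nu>)"
proof -
  have fin: "finite V" using assms by (simp add: simple_graph_def)
  have "(\<lambda>v\<in>V. 1/2) \<in> halves V"
    by (auto simp: halves_def)
  then have ne: "halves V \<noteq> {}" by blast
  have "continuous_on (halves V) (beta_half V E)"
    unfolding beta_half_def divide_inverse
    by (intro continuous_intros continuous_on_subset[OF continuous_on_product_coordinates]) auto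
  from continuous_attains_inf[OF compact_halves[OF fin] ne this]
  obtain \<mu> where \<mu>: "\<mu> \<in> halves V" "\<forall>\<nu>\<in>halves V. beta_half V E \<mu> \<le> beta_half V E \<nu>"
    by blast
  have "beta V E = beta_half V E \<mu>"
    unfolding beta_def by (rule Least_equality) (use \<mu> in auto)
  with \<mu> show ?thesis by blast
qed

end

theory Submission
  imports Defs
begin

text \<open>
Suppose that every half has \<open>\<beta> > b = 27/1024\<close>. Two kinds of halves are used. For an edge \<open>vw\<close>, the half that is 1 on
\<open>N(v)\<close>, 0 on \<open>N(w)\<close> and constant elsewhere, averaged with its mirror image, gives \<open>4 b \<le> e - e(N(v), N(w))\<close>; averaged over
the edges this bounds the density of \<open>C\<^sub>4\<close> from above. For any two vertices, filling up (or scaling down) the indicator of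
\<open>N(v) \<union> N(w)\<close> to a half bounds the number of walks of length 3 from \<open>v\<close> to \<open>w\<close> from below.

On the other hand, in a triangle-free graph the mean of a square over all independent triples, over all triples that induce
a single edge, or over all vertices is nonnegative and is a linear combination of homomorphism densities of forests and of
\<open>C\<^sub>4\<close>, \<open>C\<^sub>5\<close>, \<open>K\<^bsub>2,3\<^esub>\<close> and \<open>C\<^sub>4\<close> with a pendant edge. For every edge density some such squares contradict
the inequalities from the halves; four choices of the coefficients cover the whole range of densities.
\<close>

section \<open>Normalised averages over the vertex set\<close>

definition avg :: "'a set \<Rightarrow> ('a \<Rightarrow> real) \<Rightarrow> real" where
  "avg V f = (\<Sum>v\<in>V. f v) / real (card V)"

lemma avg_add: "avg V (\<lambda>x. f x + g x) = avg V f + avg V g"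
  by (simp add: avg_def sum.distrib add_divide_distrib)

lemma avg_diff: "avg V (\<lambda>x. f x - g x) = avg V f - avg V g"
  by (simp add: avg_def sum_subtractf diff_divide_distrib)

lemma avg_mult_left: "avg V (\<lambda>x. c * f x) = c * avg V f"
  by (simp add: avg_def sum_distrib_left)

lemma avg_mult_right: "avg V (\<lambda>x. f x * c) = avg V f * c"
  by (simp add: avg_def sum_distrib_right)

lemma avg_const: "finite V \<Longrightarrow> V \<noteq> {} \<Longrightarrow> avg V (\<lambda>x. c) = c"
  by (simp add: avg_def)

lemma avg_swap: "avg V (\<lambda>x. avg W (\<lambda>y. f x y)) = avg W (\<lambda>y. avg V (\<lambda>x. f x y))"
  unfolding avg_def sum_divide_distrib[symmetric]
  by (subst sum.swap) (simp add: mult.commute)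

lemma avg_mono: "(\<And>x. x \<in> V \<Longrightarrow> f x \<le> g x) \<Longrightarrow> avg V f \<le> avg V g"
  by (simp add: avg_def divide_right_mono sum_mono)

lemma avg_nonneg: "(\<And>x. x \<in> V \<Longrightarrow> 0 \<le> f x) \<Longrightarrow> 0 \<le> avg V f"
  by (simp add: avg_def sum_nonneg)

lemma avg_cong: "(\<And>x. x \<in> V \<Longrightarrow> f x = g x) \<Longrightarrow> avg V f = avg V g"
  by (simp add: avg_def)

section \<open>Adjacency and the density of a half\<close>

definition adj :: "'a set set \<Rightarrow> 'a \<Rightarrow> 'a \<Rightarrow> real" where
  "adj E u v = of_bool ({u, v} \<in> E)"

text \<open>An edge \<open>{a, b}\<close> arises from the two ordered pairs \<open>(a, b)\<close>
  and \<open>(b, a)\<close>, hence the factor 1/2. Grouping ordered pairs by their edge yields the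
  quadratic form.\<close>

lemma beta_half_eq_avg:
  assumes "simple_graph V E"
  shows "beta_half V E \<mu> = avg V (\<lambda>u. \<mu> u * avg V (\<lambda>v. adj E u v * \<mu> v)) / 2"
proof -
  have fV: "finite V" and sub: "\<And>e. e \<in> E \<Longrightarrow> e \<subseteq> V" and c2: "\<And>e. e \<in> E \<Longrightarrow> card e = 2"
    using assms by (auto simp: simple_graph_def)
  have fE: "finite E" using fV sub by (meson finite_Pow_iff finite_subset PowI subsetI)
  let ?S = "{p \<in> V \<times> V. {fst p, snd p} \<in> E}"
  have "(\<Sum>u\<in>V. \<mu> u * (\<Sum>v\<in>V. adj E u v * \<mu> v)) = (\<Sum>p\<in>V \<times> V. adj E (fst p) (snd p) * (\<mu> (fst p) * \<mu> (snd p)))"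
    by (simp add: sum.cartesian_product sum_distrib_left mult_ac case_prod_unfold)
  also have "\<dots> = (\<Sum>p\<in>?S. \<mu> (fst p) * \<mu> (snd p))"
    using fV by (intro sum.mono_neutral_cong_right) (auto simp: adj_def)
  also have "\<dots> = (\<Sum>e\<in>E. \<Sum>p\<in>{p \<in> ?S. {fst p, snd p} = e}. \<mu> (fst p) * \<mu> (snd p))"
    using fV fE by (intro sum.group[symmetric]) auto
  also have "\<dots> = (\<Sum>e\<in>E. 2 * (\<Prod>v\<in>e. \<mu> v))"
  proof (rule sum.cong[OF refl])
    fix e assume e: "e \<in> E"
    obtain a b where ab: "e = {a, b}" "a \<noteq> b" using c2[OF e] by (metis card_2_iff)
    have "{p \<in> ?S. {fst p, snd p} = e} = {(a, b), (b, a)}"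
    proof (rule set_eqI)
      fix p :: "'a \<times> 'a"
      obtain x y where p: "p = (x, y)" by (cases p)
      have "a \<in> V" "b \<in> V" "{a, b} \<in> E" using ab(1) e sub[OF e] by auto
      then show "p \<in> {p \<in> ?S. {fst p, snd p} = e} \<longleftrightarrow> p \<in> {(a, b), (b, a)}"
        unfolding p ab(1) by (simp add: doubleton_eq_iff) (metis insert_commute)
    qed
    with ab show "(\<Sum>p\<in>{p \<in> ?S. {fst p, snd p} = e}. \<mu> (fst p) * \<mu> (snd p)) = 2 * (\<Prod>v\<in>e. \<mu> v)"
      by simp
  qed
  finally have "(\<Sum>u\<in>V. \<mu> u * (\<Sum>v\<in>V. adj E u v * \<mu> v)) = 2 * (\<Sum>e\<in>E. \<Prod>v\<in>e. \<mu> v)"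
    by (simp add: sum_distrib_left)
  then show ?thesis
    by (simp add: beta_half_def avg_def sum_divide_distrib[symmetric] power2_eq_square)
qed

text \<open>Members of \<open>halves V\<close> are extensional, so \<open>\<mu>\<close> is
  restricted first; from here on any function with the right values on \<open>V\<close> may serve as
  a half.\<close>

lemma beta_le_half:
  assumes "simple_graph V E" "V \<noteq> {}" "\<And>v. v \<in> V \<Longrightarrow> 0 \<le> \<mu> v \<and> \<mu> v \<le> 1" "avg V \<mu> = 1/2"
  shows "beta V E \<le> avg V (\<lambda>u. \<mu> u * avg V (\<lambda>v. adj E u v * \<mu> v)) / 2"
proof -
  let ?\<nu> = "restrict \<mu> V"
  have "finite V" using assms(1) by (simp add: simple_graph_def)
  with assms(2) have "real (card V) \<noteq> 0" by simp
  then have "(\<Sum>v\<in>V. \<mu> v) = real (card V) / 2"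
    using assms(4) by (simp add: avg_def field_simps)
  then have "?\<nu> \<in> halves V"
    using assms(3) by (auto simp: halves_def)
  then have "beta V E \<le> beta_half V E ?\<nu>"
    using beta_attained[OF assms(1)] by auto
  also have "\<dots> = avg V (\<lambda>u. ?\<nu> u * avg V (\<lambda>v. adj E u v * ?\<nu> v)) / 2"
    by (rule beta_half_eq_avg[OF assms(1)])
  also have "\<dots> = avg V (\<lambda>u. \<mu> u * avg V (\<lambda>v. adj E u v * \<mu> v)) / 2"
    by (simp add: avg_def)
  finally show ?thesis .
qed

text \<open>The three laws of \<open>A\<close> hold for all arguments, also outside
  \<open>V\<close>, so they can be applied under averages without side conditions.
  \<open>A_tri\<close> with three equal vertices excludes loops.\<close>

locale tri_free =
  fixes V :: "'a set" and A :: "'a \<Rightarrow> 'a \<Rightarrow> real"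
  assumes finite_V: "finite V" and V_ne: "V \<noteq> {}"
    and A_01: "A u v = 0 \<or> A u v = 1"
    and A_sym: "A u v = A v u"
    and A_tri: "A u v * (A v w * A u w) = 0"
begin

section \<open>The adjacency operator and its bilinear form\<close>

abbreviation av :: "('a \<Rightarrow> real) \<Rightarrow> real" where "av \<equiv> avg V"

definition nb :: "('a \<Rightarrow> real) \<Rightarrow> 'a \<Rightarrow> real" where "nb f u = av (\<lambda>x. A u x * f x)"
definition Q :: "('a \<Rightarrow> real) \<Rightarrow> real" where "Q f = av (\<lambda>u. f u * nb f u) / 2"
definition deg :: "'a \<Rightarrow> real" where "deg u = av (\<lambda>x. A u x)"
definition cod :: "'a \<Rightarrow> 'a \<Rightarrow> real" where "cod u v = av (\<lambda>x. A u x * A v x)"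
definition walk3 :: "'a \<Rightarrow> 'a \<Rightarrow> real" where "walk3 u v = av (\<lambda>x. A u x * cod x v)"

lemma av_const [simp]: "av (\<lambda>x. c) = c"
  using finite_V V_ne by (rule avg_const)

lemmas av_simps = avg_add avg_diff avg_mult_left avg_mult_right

lemma A_nonneg: "0 \<le> A u v" and A_le_1: "A u v \<le> 1"
  using A_01[of u v] by auto

text \<open>Self-adjointness, by exchanging the two averages and symmetry of \<open>A\<close>.
  Moving \<open>nb\<close> from one factor to the other evaluates many of the densities
  below.\<close>

lemma nb_adjoint: "av (\<lambda>u. f u * nb g u) = av (\<lambda>u. nb f u * g u)"
proof -
  have "f u * nb g u = av (\<lambda>x. f u * (A u x * g x))" for u
    unfolding nb_def avg_mult_left ..
  moreover have "nb f x * g x = av (\<lambda>u. f u * (A u x * g x))" for x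
  proof -
    have "(\<lambda>u. f u * (A u x * g x)) = (\<lambda>u. (A x u * f u) * g x)"
      by (rule ext) (simp only: A_sym[of x] mult_ac)
    then show ?thesis unfolding nb_def by (simp only: avg_mult_right)
  qed
  ultimately show ?thesis by (simp only: avg_swap[of V V "\<lambda>u x. f u * (A u x * g x)"])
qed

lemma nb_add: "nb (\<lambda>x. f x + g x) u = nb f u + nb g u"
  by (simp add: nb_def av_simps distrib_left)

lemma nb_diff: "nb (\<lambda>x. f x - g x) u = nb f u - nb g u"
  by (simp add: nb_def av_simps right_diff_distrib)

lemma nb_scale: "nb (\<lambda>x. c * f x) u = c * nb f u"
  unfolding nb_def by (simp only: mult.left_commute[of _ c] avg_mult_left)

lemma nb_one: "nb (\<lambda>x. 1) = deg"
  by (simp add: nb_def deg_def fun_eq_iff)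

definition bil :: "('a \<Rightarrow> real) \<Rightarrow> ('a \<Rightarrow> real) \<Rightarrow> real" where "bil f g = av (\<lambda>u. f u * nb g u)"

lemma Q_bil: "Q f = bil f f / 2" by (simp add: Q_def bil_def)

lemma bil_sym: "bil f g = bil g f"
  unfolding bil_def nb_adjoint[of f g] by (simp only: mult.commute)

lemma bil_add_right: "bil f (\<lambda>x. g x + h x) = bil f g + bil f h"
  by (simp add: bil_def nb_add av_simps distrib_left)

lemma bil_scale_right: "bil f (\<lambda>x. c * g x) = c * bil f g"
  unfolding bil_def nb_scale by (simp only: mult.left_commute[of _ c] avg_mult_left)

lemma bil_diff_right: "bil f (\<lambda>x. g x - h x) = bil f g - bil f h"
  by (simp add: bil_def nb_diff av_simps right_diff_distrib)

lemma bil_add_left: "bil (\<lambda>x. g x + h x) f = bil g f + bil h f"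
  using bil_add_right bil_sym by metis

lemma bil_scale_left: "bil (\<lambda>x. c * g x) f = c * bil g f"
  using bil_scale_right bil_sym by metis

lemma bil_diff_left: "bil (\<lambda>x. g x - h x) f = bil g f - bil h f"
  using bil_diff_right bil_sym by metis

lemmas bil_simps = bil_add_right bil_scale_right bil_diff_right bil_add_left bil_scale_left bil_diff_left

lemma bil_nonneg:
  assumes "\<And>x. x \<in> V \<Longrightarrow> 0 \<le> f x" "\<And>x. x \<in> V \<Longrightarrow> 0 \<le> g x"
  shows "0 \<le> bil f g"
  unfolding bil_def nb_def using assms A_nonneg by (intro avg_nonneg mult_nonneg_nonneg) auto

lemma walk3_bil: "walk3 v w = bil (A v) (A w)"
  by (simp add: walk3_def cod_def bil_def nb_def A_sym mult_ac)

text \<open>The neighbourhood of \<open>v\<close> is independent in a triangle-free graph, so no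
  edge joins the supports of \<open>f\<close> and \<open>g\<close>.\<close>

lemma bil_nbhd_eq_0:
  assumes "\<And>x. x \<in> V \<Longrightarrow> f x \<noteq> 0 \<Longrightarrow> A v x = 1" "\<And>x. x \<in> V \<Longrightarrow> g x \<noteq> 0 \<Longrightarrow> A v x = 1"
  shows "bil f g = 0"
proof -
  have "f u * (A u x * g x) = 0" if "u \<in> V" "x \<in> V" for u x
    using assms(1)[of u] assms(2)[of x] that A_tri[of v u x] by (auto simp: A_sym)
  then have "av (\<lambda>u. av (\<lambda>x. f u * (A u x * g x))) = av (\<lambda>u. av (\<lambda>x. 0))"
    by (intro avg_cong) auto
  then show ?thesis
    by (simp add: bil_def nb_def avg_mult_left)
qed

definition D :: real where "D = av deg"

lemma deg_nonneg: "0 \<le> deg v"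
  unfolding deg_def using A_nonneg by (intro avg_nonneg) auto

subsection \<open>Homomorphism densities\<close>

definition av2 :: "('a \<Rightarrow> 'a \<Rightarrow> real) \<Rightarrow> real" where "av2 f = av (\<lambda>u. av (\<lambda>v. f u v))"
definition av3 :: "('a \<Rightarrow> 'a \<Rightarrow> 'a \<Rightarrow> real) \<Rightarrow> real" where
  "av3 f = av (\<lambda>u. av (\<lambda>v. av (\<lambda>w. f u v w)))"

lemma av2_lin: "av2 (\<lambda>u v. f u v + g u v) = av2 f + av2 g"
  "av2 (\<lambda>u v. f u v - g u v) = av2 f - av2 g" "av2 (\<lambda>u v. c * f u v) = c * av2 f"
  by (simp_all add: av2_def av_simps)

lemma av3_lin: "av3 (\<lambda>u v w. f u v w + g u v w) = av3 f + av3 g"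
  "av3 (\<lambda>u v w. f u v w - g u v w) = av3 f - av3 g" "av3 (\<lambda>u v w. c * f u v w) = c * av3 f"
  by (simp_all add: av3_def av_simps)

lemma av2_swap: "av2 (\<lambda>u v. f v u) = av2 f"
  unfolding av2_def by (rule avg_swap)

lemma av3_swap12: "av3 (\<lambda>u v w. f v u w) = av3 f"
  unfolding av3_def by (rule avg_swap)

lemma av3_swap23: "av3 (\<lambda>u v w. f u w v) = av3 f"
  unfolding av3_def by (simp only: avg_swap[of V V "\<lambda>w v. f _ w v"])

lemma av3_rot: "av3 (\<lambda>u v w. f v w u) = av3 f"
  using av3_swap12[of "\<lambda>u v w. f u w v"] av3_swap23[of f] by simp

lemma av2_prod: "av2 (\<lambda>u v. f u * g v) = av f * av g"
  by (simp add: av2_def av_simps)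

lemma av2_A: "av2 (\<lambda>u v. A u v * (f u * g v)) = av (\<lambda>u. f u * nb g u)"
  unfolding av2_def nb_def by (simp only: mult.left_commute[of "A _ _" "f _"] avg_mult_left)

text \<open>\<open>cod\<close> is the kernel of the squared adjacency operator; likewise
  \<open>walk3\<close> is that of its cube in \<open>av_walk3\<close>.\<close>

lemma av_cod: "av (\<lambda>v. cod u v * f v) = nb (nb f) u"
proof -
  have "cod u v * f v = av (\<lambda>x. A u x * (A x v * f v))" for v
    unfolding cod_def avg_mult_right[symmetric] A_sym[of v] by (simp only: mult.assoc)
  then have "av (\<lambda>v. cod u v * f v) = av (\<lambda>x. av (\<lambda>v. A u x * (A x v * f v)))"
    by (simp only: avg_swap[of V V "\<lambda>v x. A u x * (A x v * f v)"])
  then show ?thesis unfolding nb_def by (simp only: avg_mult_left)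
qed

lemma av2_cod: "av2 (\<lambda>u v. cod u v * (f u * g v)) = av (\<lambda>u. nb f u * nb g u)"
  unfolding av2_def by (simp only: mult.left_commute[of "cod _ _" "f _"] avg_mult_left av_cod nb_adjoint[of f "nb g"])

lemma av_walk3: "av (\<lambda>v. walk3 u v * f v) = nb (nb (nb f)) u"
proof -
  have "walk3 u v * f v = av (\<lambda>x. A u x * (cod x v * f v))" for v
    unfolding walk3_def avg_mult_right[symmetric] by (simp only: mult.assoc)
  then have "av (\<lambda>v. walk3 u v * f v) = av (\<lambda>x. av (\<lambda>v. A u x * (cod x v * f v)))"
    by (simp only: avg_swap[of V V "\<lambda>v x. A u x * (cod x v * f v)"])
  then show ?thesis unfolding nb_def[of "nb (nb f)"] by (simp only: avg_mult_left av_cod)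
qed

lemma cod_eq_nb: "cod u v = nb (A v) u"
  unfolding cod_def nb_def ..

text \<open>A walk of length 3 can be cut next to either end. The definition cuts off the edge at
  \<open>u\<close>; this form cuts off the edge at \<open>v\<close>.\<close>

lemma walk3_eq_nb: "walk3 u v = nb (cod u) v"
proof -
  have "walk3 u v = nb (nb (A v)) u"
    unfolding walk3_def nb_def[of "nb (A v)"] cod_eq_nb ..
  also have "\<dots> = nb (cod u) v"
    unfolding av_cod[symmetric] nb_def[of "cod u"] by (simp only: mult.commute)
  finally show ?thesis .
qed

lemma cod_sym: "cod u v = cod v u"
  unfolding cod_def by (simp only: mult.commute)

text \<open>A common neighbour of adjacent vertices would complete a triangle.\<close>

lemma A_cod [simp]: "A u v * cod u v = 0" "A u v * (cod u v * c) = 0"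
proof -
  show "A u v * cod u v = 0"
  proof (cases "A u v = 0")
    case False
    then have "A u v = 1" using A_01 by blast
    then have "A u x * A v x = 0" for x using A_tri[of u v x] by auto
    then have "cod u v = av (\<lambda>x. 0)" unfolding cod_def by (intro avg_cong)
    then show ?thesis by simp
  qed simp
  then show "A u v * (cod u v * c) = 0" by auto
qed

definition deg2 :: "'a \<Rightarrow> real" where "deg2 = nb deg"

lemma av_nb: "av (nb f) = av (\<lambda>v. deg v * f v)"
  using nb_adjoint[of "\<lambda>x. 1" f] by (simp add: nb_one)

text \<open>
Homomorphism densities: \<open>S2\<close>, \<open>S3\<close>, \<open>S4\<close> are stars, \<open>P3\<close> and \<open>P4\<close> paths, the index counting edges; \<open>F3\<close> is the path
\<open>P3\<close> with an edge attached to an inner vertex, and \<open>C4'\<close> is the cycle \<open>C4\<close> with a pendant edge.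
\<close>

definition S2 :: real where "S2 = av (\<lambda>v. deg v * deg v)"
definition S3 :: real where "S3 = av (\<lambda>v. deg v * (deg v * deg v))"
definition S4 :: real where "S4 = av (\<lambda>v. deg v * (deg v * (deg v * deg v)))"
definition P3 :: real where "P3 = av (\<lambda>v. deg v * deg2 v)"
definition F3 :: real where "F3 = av (\<lambda>v. deg v * (deg v * deg2 v))"
definition P4 :: real where "P4 = av (\<lambda>v. deg2 v * deg2 v)"
definition C4 :: real where "C4 = av2 (\<lambda>u v. cod u v * cod u v)"
definition C4' :: real where "C4' = av2 (\<lambda>u v. deg u * (cod u v * cod u v))"
definition K23 :: real where "K23 = av2 (\<lambda>u v. cod u v * (cod u v * cod u v))"
definition C5 :: real where "C5 = av2 (\<lambda>u v. cod u v * walk3 u v)"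

lemma av2_deg: "av2 (\<lambda>u v. deg u) = D" "av2 (\<lambda>u v. deg u * deg u) = S2" 
  "av2 (\<lambda>u v. deg u * deg v) = D * D" "av2 (\<lambda>u v. deg u * (deg u * deg u)) = S3"
  "av2 (\<lambda>u v. deg u * (deg v * deg v)) = D * S2" "av2 (\<lambda>u v. deg u * (deg u * deg v)) = D * S2"
  by (simp_all add: av2_def av_simps D_def S2_def S3_def mult.assoc[symmetric])
    (simp_all add: mult.assoc av_simps)

lemma av2_A_deg: "av2 (\<lambda>u v. A u v * deg u) = S2" "av2 (\<lambda>u v. A u v * (deg u * deg u)) = S3"
  "av2 (\<lambda>u v. A u v * (deg u * deg v)) = P3" "av2 (\<lambda>u v. A u v * (deg u * (deg u * deg u))) = S4"
  "av2 (\<lambda>u v. A u v * (deg u * (deg u * deg v))) = F3" "av2 (\<lambda>u v. A u v * (deg u * (deg v * deg v))) = F3"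
proof -
  show "av2 (\<lambda>u v. A u v * deg u) = S2"
    using av2_A[of deg "\<lambda>x. 1"] by (simp add: nb_one S2_def)
  show "av2 (\<lambda>u v. A u v * (deg u * deg u)) = S3"
    using av2_A[of "\<lambda>u. deg u * deg u" "\<lambda>x. 1"] by (simp add: nb_one S3_def mult.assoc)
  show "av2 (\<lambda>u v. A u v * (deg u * deg v)) = P3"
    using av2_A[of deg deg] by (simp add: P3_def deg2_def)
  show "av2 (\<lambda>u v. A u v * (deg u * (deg u * deg u))) = S4"
    using av2_A[of "\<lambda>u. deg u * (deg u * deg u)" "\<lambda>x. 1"] by (simp add: nb_one S4_def mult.assoc)
  show 1: "av2 (\<lambda>u v. A u v * (deg u * (deg u * deg v))) = F3"
    using av2_A[of "\<lambda>u. deg u * deg u" deg] by (simp add: F3_def deg2_def mult.assoc)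
  have "av2 (\<lambda>u v. A u v * (deg u * (deg v * deg v))) = av2 (\<lambda>u v. A v u * (deg v * (deg v * deg u)))"
    by (simp add: A_sym mult_ac)
  then show "av2 (\<lambda>u v. A u v * (deg u * (deg v * deg v))) = F3"
    using 1 av2_swap[of "\<lambda>u v. A u v * (deg u * (deg u * deg v))"] by simp
qed

lemma av2_cod_deg: "av2 (\<lambda>u v. cod u v) = S2" 
  "av2 (\<lambda>u v. cod u v * deg u) = P3" "av2 (\<lambda>u v. cod u v * deg v) = P3"
  "av2 (\<lambda>u v. cod u v * (deg u * deg v)) = P4"
  "av2 (\<lambda>u v. cod u v * (deg u * deg u)) = F3" "av2 (\<lambda>u v. cod u v * (deg v * deg v)) = F3"
  "av2 (\<lambda>u v. cod u v * (cod u v * deg u)) = C4'" "av2 (\<lambda>u v. cod u v * (cod u v * deg v)) = C4'"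
proof -
  show "av2 (\<lambda>u v. cod u v) = S2"
    using av2_cod[of "\<lambda>x. 1" "\<lambda>x. 1"] by (simp add: nb_one S2_def)
  show "av2 (\<lambda>u v. cod u v * deg u) = P3" 
    using av2_cod[of deg "\<lambda>x. 1"] by (simp add: nb_one P3_def deg2_def mult.commute)
  show "av2 (\<lambda>u v. cod u v * deg v) = P3"
    using av2_cod[of "\<lambda>x. 1" deg] by (simp add: nb_one P3_def deg2_def)
  show "av2 (\<lambda>u v. cod u v * (deg u * deg v)) = P4"
    using av2_cod[of deg deg] by (simp add: P4_def deg2_def)
  show 1: "av2 (\<lambda>u v. cod u v * (deg u * deg u)) = F3"
    using av2_cod[of "\<lambda>u. deg u * deg u" "\<lambda>x. 1"] nb_adjoint[of "\<lambda>u. deg u * deg u" deg]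
    by (simp add: nb_one F3_def deg2_def mult.assoc)
  show "av2 (\<lambda>u v. cod u v * (deg v * deg v)) = F3"
    using 1 av2_swap[of "\<lambda>u v. cod u v * (deg u * deg u)"] by (simp add: cod_sym)
  show 2: "av2 (\<lambda>u v. cod u v * (cod u v * deg u)) = C4'"
    by (simp add: C4'_def mult_ac)
  show "av2 (\<lambda>u v. cod u v * (cod u v * deg v)) = C4'"
    using 2 av2_swap[of "\<lambda>u v. cod u v * (cod u v * deg u)"] by (simp add: cod_sym)
qed

lemma av2_walk3: "av2 (\<lambda>u v. deg u * walk3 u v) = P4" "av2 (\<lambda>u v. A u v * walk3 u v) = C4"
  "av2 (\<lambda>u v. A u v * (deg u * walk3 u v)) = C4'"
proof -
  have "av (walk3 u) = nb deg2 u" for u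
    using av_walk3[of u "\<lambda>x. 1"] by (simp add: nb_one deg2_def)
  then show "av2 (\<lambda>u v. deg u * walk3 u v) = P4"
    using nb_adjoint[of deg deg2] by (simp add: av2_def avg_mult_left P4_def deg2_def)
  \<comment> \<open>An edge \<open>uv\<close> and a walk of length 3 between its ends form a closed
    walk of length 4, counted here by the vertex \<open>x\<close> opposite to
    \<open>u\<close>.\<close>
  have *: "av (\<lambda>v. A u v * walk3 u v) = av (\<lambda>x. cod u x * cod u x)" for u
    unfolding walk3_eq_nb nb_def[symmetric] av_cod ..
  show "av2 (\<lambda>u v. A u v * walk3 u v) = C4"
    by (simp add: av2_def * C4_def)
  show "av2 (\<lambda>u v. A u v * (deg u * walk3 u v)) = C4'"
    by (simp add: av2_def * C4'_def mult.left_commute[of "A _ _" "deg _"] avg_mult_left)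
qed

lemma av2_nonneg: "(\<And>u v. u \<in> V \<Longrightarrow> v \<in> V \<Longrightarrow> 0 \<le> f u v) \<Longrightarrow> 0 \<le> av2 f"
  unfolding av2_def by (intro avg_nonneg)

lemma av2_mono: "(\<And>u v. u \<in> V \<Longrightarrow> v \<in> V \<Longrightarrow> f u v \<le> g u v) \<Longrightarrow> av2 f \<le> av2 g"
  unfolding av2_def by (intro avg_mono)

lemma cod_le_deg: "cod u v \<le> deg u"
  unfolding cod_def deg_def using A_nonneg A_le_1 by (intro avg_mono) (simp add: mult_left_le)

text \<open>This is the average needed for \<open>pair_form_nonneg\<close>:
  \<open>deg v + deg w - cod v w\<close> is the measure of the union of the two neighbourhoods.
  Products of \<open>A\<close> with \<open>cod\<close> vanish, so only the listed densities
  occur.\<close>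

lemma av2_pair:
  "av2 (\<lambda>v w. (1 - A v w) * (deg v - cod v w) *
     (walk3 v w + c0 + c1 * (deg v + deg w - cod v w) + c2 * (deg v + deg w - cod v w)\<^sup>2))
   = (P4 - C4' - C5) + c0 * (D - 2 * S2) + c1 * (S2 + D * D - 4 * P3 - S3 + C4)
     + c2 * (S3 + 3 * (D * S2) + 5 * C4' - 7 * F3 - 4 * P4 - S4 - K23)"
  (is "av2 ?L = _")
proof -
  have L: "?L v w =
     deg v * walk3 v w - A v w * (deg v * walk3 v w) - cod v w * walk3 v w
     + c0 * (deg v - A v w * deg v - cod v w)
     + c1 * (deg v * deg v + deg v * deg w - cod v w * deg v - A v w * (deg v * deg v) - A v w * (deg v * deg w)
        - cod v w * deg v - cod v w * deg w + cod v w * cod v w)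
     + c2 * (deg v * (deg v * deg v) + deg v * (deg w * deg w) + cod v w * (cod v w * deg v)
        + 2 * (deg v * (deg v * deg w)) - 2 * (cod v w * (deg v * deg v)) - 2 * (cod v w * (deg v * deg w))
        - A v w * (deg v * (deg v * deg v)) - 2 * (A v w * (deg v * (deg v * deg w))) - A v w * (deg v * (deg w * deg w))
        - cod v w * (deg v * deg v) - cod v w * (deg w * deg w) - cod v w * (cod v w * cod v w)
        - 2 * (cod v w * (deg v * deg w)) + 2 * (cod v w * (cod v w * deg v)) + 2 * (cod v w * (cod v w * deg w)))" for v w
  \<comment> \<open>Off the edges this is plain expansion; on an edge \<open>cod v w = 0\<close> and
    both sides cancel to 0.\<close>
  proof (cases "A v w = 0")
    case True
    then show ?thesis by (simp add: power2_eq_square algebra_simps)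
  next
    case False
    then have "A v w = 1" "cod v w = 0" using A_01[of v w] A_cod(1)[of v w] by auto
    then show ?thesis by (simp add: power2_eq_square algebra_simps)
  qed
  show ?thesis
    unfolding L av2_lin av2_deg av2_A_deg av2_cod_deg av2_walk3 C5_def[symmetric] C4_def[symmetric] K23_def[symmetric]
    by (simp add: algebra_simps)
qed

section \<open>Averages over triples\<close>

lemma av3_pair: "av3 (\<lambda>u v w. f u v) = av2 f" "av3 (\<lambda>u v w. f u w) = av2 f" "av3 (\<lambda>u v w. f v w) = av2 f"
  by (simp_all add: av3_def av2_def)

text \<open>Once the shared vertex is fixed, the other two average independently.\<close>

lemma av3_share: "av3 (\<lambda>u v w. f u v * g u w) = av (\<lambda>u. av (f u) * av (g u))"
  "av3 (\<lambda>u v w. f u v * g v w) = av (\<lambda>v. av (\<lambda>u. f u v) * av (g v))"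
  "av3 (\<lambda>u v w. f u w * g v w) = av (\<lambda>w. av (\<lambda>u. f u w) * av (\<lambda>v. g v w))"
proof -
  show 1: "av3 (\<lambda>u v w. f u v * g u w) = av (\<lambda>u. av (f u) * av (g u))" for f g
    by (simp add: av3_def av_simps)
  show "av3 (\<lambda>u v w. f u v * g v w) = av (\<lambda>v. av (\<lambda>u. f u v) * av (g v))"
    using av3_swap12[of "\<lambda>v u w. f u v * g v w"] 1[of "\<lambda>v u. f u v" g] by simp
  show "av3 (\<lambda>u v w. f u w * g v w) = av (\<lambda>w. av (\<lambda>u. f u w) * av (\<lambda>v. g v w))"
    using av3_rot[of "\<lambda>w u v. f u w * g v w"] av3_rot[of "\<lambda>v w u. f u w * g v w"] 1[of "\<lambda>w u. f u w" "\<lambda>w v. g v w"] by simp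
qed

lemma av3_A_A: "av3 (\<lambda>u v w. A u v * (A u w * g v w)) = av2 (\<lambda>v w. cod v w * g v w)"
proof -
  have "av3 (\<lambda>u v w. A u v * (A u w * g v w)) = av3 (\<lambda>v w u. A u v * (A u w * g v w))"
    using av3_rot[of "\<lambda>v w u. A u v * (A u w * g v w)"] by simp
  also have "\<dots> = av2 (\<lambda>v w. cod v w * g v w)"
    unfolding av3_def av2_def cod_def avg_mult_right[symmetric] by (simp only: A_sym mult.assoc)
  finally show ?thesis .
qed

lemma av3_A_left: "av3 (\<lambda>u v w. A u v * f u w) = av2 (\<lambda>u w. deg u * f u w)"
  unfolding av3_share av2_def avg_mult_left deg_def[symmetric] ..

text \<open>An edge \<open>uv\<close> whose ends are both joined to \<open>w\<close> by paths of
  length 2 closes to a 5-cycle; averaging over \<open>v\<close> first produces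
  \<open>walk3 u w\<close>.\<close>

lemma av3_A_cod_cod: "av3 (\<lambda>u v w. A u v * (cod u w * cod v w)) = C5"
proof -
  have "av (\<lambda>v. A u v * (cod u w * cod v w)) = cod u w * walk3 u w" for u w
    unfolding walk3_def avg_mult_left[symmetric] by (simp only: mult.left_commute)
  then show ?thesis
    using av3_swap23[of "\<lambda>u v w. A u v * (cod u w * cod v w)"]
    unfolding C5_def av2_def av3_def by (simp only:)
qed

section \<open>Squares over triples inducing one edge, and over vertices\<close>

lemma av3_nonneg: "(\<And>u v w. 0 \<le> f u v w) \<Longrightarrow> 0 \<le> av3 f"
  unfolding av3_def by (intro avg_nonneg)

text \<open>The \<open>av3\<close> mean of
  \<open>(a + c * deg w + e * (cod u w + cod v w))\<^sup>2\<close> times the indicator that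
  \<open>uv\<close> is the only edge among \<open>u\<close>, \<open>v\<close>, \<open>w\<close>,
  expanded into densities.\<close>

definition edge_form :: "real \<Rightarrow> real \<Rightarrow> real \<Rightarrow> real" where
  "edge_form a c e = a\<^sup>2 * (D - 2 * S2) + 2 * a * c * (D * D - 2 * P3) + 2 * a * e * (2 * P3 - 2 * C4)
     + c\<^sup>2 * (D * S2 - 2 * F3) + 2 * c * e * (2 * P4 - 2 * C4') + e\<^sup>2 * (2 * C4' + 2 * C5 - 2 * K23)"

lemma edge_form_nonneg: "0 \<le> edge_form a c e"
proof -
  let ?X = "\<lambda>u v w. (a + c * deg w + e * (cod u w + cod v w))\<^sup>2"
  let ?L = "\<lambda>u v w. A u v * ((1 - A u w) * (1 - A v w)) * ?X u v w"
  have "0 \<le> av3 ?L"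
    using A_nonneg A_le_1 by (intro av3_nonneg mult_nonneg_nonneg) auto
  \<comment> \<open>The product of all three adjacencies vanishes. The last term is written with
    \<open>u\<close> and \<open>v\<close> exchanged, so that its mean equals that of the term before
    it.\<close>
  also have "?L = (\<lambda>u v w. A u v * ?X u v w - A u v * (A u w * ?X u v w) - A v u * (A v w * ?X v u w))"
  proof (intro ext)
    fix u v w
    have "A u v * (A u w * A v w) = 0" using A_tri[of u v w] by (simp add: mult.commute)
    then show "?L u v w = A u v * ?X u v w - A u v * (A u w * ?X u v w) - A v u * (A v w * ?X v u w)"
      by (auto simp: A_sym[of v u] algebra_simps)
  qed
  also have "av3 \<dots> = av3 (\<lambda>u v w. A u v * ?X u v w) - 2 * av3 (\<lambda>u v w. A u v * (A u w * ?X u v w))"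
    unfolding av3_lin(2) av3_swap12[of "\<lambda>u v w. A u v * (A u w * ?X u v w)"] by simp
  also have "av3 (\<lambda>u v w. A u v * ?X u v w) =
     a\<^sup>2 * D + 2 * a * c * (D * D) + 4 * a * e * P3 + c\<^sup>2 * (D * S2) + 4 * c * e * P4 + e\<^sup>2 * (2 * C4' + 2 * C5)"
  proof -
    have sym: "av3 (\<lambda>u v w. A u v * f v w) = av3 (\<lambda>u v w. A u v * f u w)" for f
      using av3_swap12[of "\<lambda>u v w. A u v * f u w"] by (simp add: A_sym)
    have X: "A u v * ?X u v w = a\<^sup>2 * A u v + 2 * a * c * (A u v * deg w) + 2 * a * e * (A u v * cod u w)
        + 2 * a * e * (A u v * cod v w) + c\<^sup>2 * (A u v * (deg w * deg w)) + 2 * c * e * (A u v * (deg w * cod u w))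
        + 2 * c * e * (A u v * (deg w * cod v w)) + e\<^sup>2 * (A u v * (cod u w * cod u w)) + e\<^sup>2 * (A u v * (cod v w * cod v w))
        + 2 * e\<^sup>2 * (A u v * (cod u w * cod v w))" for u v w
      by (simp add: power2_eq_square algebra_simps)
    have 1: "av3 (\<lambda>u v w. A u v) = D" "av3 (\<lambda>u v w. A u v * deg w) = D * D"
      "av3 (\<lambda>u v w. A u v * (deg w * deg w)) = D * S2"
      by (simp_all add: av3_def av_simps deg_def[symmetric] D_def S2_def mult.commute)
    have 2: "av3 (\<lambda>u v w. A u v * cod u w) = P3" "av3 (\<lambda>u v w. A u v * (deg w * cod u w)) = P4"
      "av3 (\<lambda>u v w. A u v * (cod u w * cod u w)) = C4'"
      unfolding av3_A_left C4'_def using av2_cod_deg(2,4) by (simp_all add: mult_ac)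
    show ?thesis
      unfolding X av3_lin sym[of "\<lambda>v w. cod v w"] sym[of "\<lambda>v w. deg w * cod v w"] sym[of "\<lambda>v w. cod v w * cod v w"] 1 2 av3_A_cod_cod
      by (simp add: algebra_simps)
  qed
  also have "av3 (\<lambda>u v w. A u v * (A u w * ?X u v w)) =
     a\<^sup>2 * S2 + 2 * a * c * P3 + 2 * a * e * C4 + c\<^sup>2 * F3 + 2 * c * e * C4' + e\<^sup>2 * K23"
  proof -
    \<comment> \<open>On an edge \<open>uw\<close> the codegree \<open>cod u w\<close> is 0 and
      leaves the square.\<close>
    have X: "A u v * (A u w * ?X u v w) = A u v * (A u w * (a + c * deg w + e * cod v w)\<^sup>2)" for u v w
    proof -
      have "A u w = 0 \<or> cod u w = 0" using A_cod(1)[of u w] by (simp del: A_cod)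
      then show ?thesis by auto
    qed
    have Y: "cod v w * (a + c * deg w + e * cod v w)\<^sup>2 = a\<^sup>2 * cod v w + 2 * a * c * (cod v w * deg w)
        + 2 * a * e * (cod v w * cod v w) + c\<^sup>2 * (cod v w * (deg w * deg w)) + 2 * c * e * (cod v w * (cod v w * deg w))
        + e\<^sup>2 * (cod v w * (cod v w * cod v w))" for v w
      by (simp add: power2_eq_square algebra_simps)
    show ?thesis
      unfolding X av3_A_A Y av2_lin av2_cod_deg C4_def[symmetric] K23_def[symmetric] ..
  qed
  finally show ?thesis by (simp add: edge_form_def algebra_simps)
qed

text \<open>The mean of \<open>(a + c * deg v + e * (deg v * deg v) + f * deg2 v)\<^sup>2\<close>
  over all vertices.\<close>

definition vertex_form :: "real \<Rightarrow> real \<Rightarrow> real \<Rightarrow> real \<Rightarrow> real" where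
  "vertex_form a c e f = a\<^sup>2 + 2 * a * c * D + 2 * a * e * S2 + 2 * a * f * S2 + c\<^sup>2 * S2 + 2 * c * e * S3 + 2 * c * f * P3
     + e\<^sup>2 * S4 + 2 * e * f * F3 + f\<^sup>2 * P4"

lemma vertex_form_nonneg: "0 \<le> vertex_form a c e f"
proof -
  have avd: "av deg2 = S2"
    unfolding deg2_def av_nb S2_def ..
  have "0 \<le> av (\<lambda>v. (a + c * deg v + e * (deg v * deg v) + f * deg2 v)\<^sup>2)"
    by (intro avg_nonneg) simp
  also have "(\<lambda>v. (a + c * deg v + e * (deg v * deg v) + f * deg2 v)\<^sup>2) = (\<lambda>v. a\<^sup>2 + 2 * a * c * deg v
      + 2 * a * e * (deg v * deg v) + 2 * a * f * deg2 v + c\<^sup>2 * (deg v * deg v) + 2 * c * e * (deg v * (deg v * deg v))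
      + 2 * c * f * (deg v * deg2 v) + e\<^sup>2 * (deg v * (deg v * (deg v * deg v))) + 2 * e * f * (deg v * (deg v * deg2 v))
      + f\<^sup>2 * (deg2 v * deg2 v))"
    by (simp add: fun_eq_iff power2_eq_square algebra_simps)
  finally show ?thesis
    unfolding vertex_form_def av_simps av_const D_def[symmetric] S2_def[symmetric] S3_def[symmetric] S4_def[symmetric] P3_def[symmetric]
      F3_def[symmetric] P4_def[symmetric] avd .
qed

section \<open>Common neighbours of three vertices\<close>

definition cod3 :: "'a \<Rightarrow> 'a \<Rightarrow> 'a \<Rightarrow> real" where "cod3 u v w = av (\<lambda>x. A x u * (A x v * A x w))"

text \<open>Two adjacent vertices among \<open>u\<close>, \<open>v\<close>, \<open>w\<close> would
  form a triangle with any common neighbour. Thus \<open>cod3\<close> is supported on independent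
  triples.\<close>

lemma A_cod3 [simp]: "A u v * cod3 u v w = 0" "A u w * cod3 u v w = 0" "A v w * cod3 u v w = 0"
proof -
  have z: "A u v * (A x u * (A x v * A x w)) = 0" "A u w * (A x u * (A x v * A x w)) = 0"
    "A v w * (A x u * (A x v * A x w)) = 0" for x
    using A_tri[of x u v] A_tri[of x u w] A_tri[of x v w] by auto
  then show "A u v * cod3 u v w = 0" "A u w * cod3 u v w = 0" "A v w * cod3 u v w = 0"
    unfolding cod3_def avg_mult_left[symmetric] z av_const by simp_all
qed

lemma av_cod3: "av (\<lambda>w. cod3 u v w * f w) = av (\<lambda>x. A x u * (A x v * nb f x))"
proof -
  have "cod3 u v w * f w = av (\<lambda>x. A x u * (A x v * (A x w * f w)))" for w
    unfolding cod3_def avg_mult_right[symmetric] by (simp only: mult.assoc)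
  then show ?thesis
    unfolding nb_def avg_mult_left[symmetric] by (simp only: avg_swap[of V V "\<lambda>w x. A x u * (A x v * (A x w * f w))"])
qed

lemma av3_cod3: "av3 (\<lambda>u v w. cod3 u v w * (g u v * f w)) = av (\<lambda>x. nb f x * av2 (\<lambda>u v. A x u * (A x v * g u v)))"
proof -
  have "av (\<lambda>w. cod3 u v w * (g u v * f w)) = av (\<lambda>x. A x u * (A x v * g u v) * nb f x)" for u v
  proof -
    have "av (\<lambda>w. cod3 u v w * (g u v * f w)) = g u v * av (\<lambda>x. A x u * (A x v * nb f x))"
      unfolding mult.left_commute[of "cod3 _ _ _"] avg_mult_left av_cod3 ..
    then show ?thesis
      unfolding avg_mult_left[symmetric] by (simp only: mult_ac)
  qed
  then have "av3 (\<lambda>u v w. cod3 u v w * (g u v * f w)) = av3 (\<lambda>u v x. A x u * (A x v * g u v) * nb f x)"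
    unfolding av3_def by (simp only:)
  also have "\<dots> = av3 (\<lambda>x u v. A x u * (A x v * g u v) * nb f x)"
    using av3_rot[of "\<lambda>x u v. A x u * (A x v * g u v) * nb f x"] av3_rot[of "\<lambda>u v x. A x u * (A x v * g u v) * nb f x"] by simp
  also have "\<dots> = av (\<lambda>x. nb f x * av2 (\<lambda>u v. A x u * (A x v * g u v)))"
    unfolding av3_def av2_def by (simp only: avg_mult_right mult.commute[of "nb f _"])
  finally show ?thesis .
qed

lemma av3_av_swap: "av3 (\<lambda>u v w. av (\<lambda>x. h x u v w)) = av (\<lambda>x. av3 (h x))"
  unfolding av3_def by (simp only: avg_swap[of V V "\<lambda>w x. h x _ _ w"] avg_swap[of V V "\<lambda>v x. av (\<lambda>w. h x _ v w)"]
      avg_swap[of V V "\<lambda>u x. av (\<lambda>v. av (\<lambda>w. h x u v w))"])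

lemma av3_prod: "av3 (\<lambda>u v w. f u * (g v * h w)) = av f * (av g * av h)"
  by (simp add: av3_def av_simps)

lemma av3_cod3_cod3: "av3 (\<lambda>u v w. cod3 u v w * cod3 u v w) = K23"
proof -
  have "cod3 u v w * cod3 u v w = av (\<lambda>x. av (\<lambda>y. (A x u * A y u) * ((A x v * A y v) * (A x w * A y w))))" for u v w
  proof -
    have "cod3 u v w * cod3 u v w = av (\<lambda>x. av (\<lambda>y. (A x u * (A x v * A x w)) * (A y u * (A y v * A y w))))"
      unfolding cod3_def avg_mult_left avg_mult_right ..
    then show ?thesis by (simp only: mult_ac)
  qed
  then have "av3 (\<lambda>u v w. cod3 u v w * cod3 u v w) =
      av (\<lambda>x. av (\<lambda>y. av3 (\<lambda>u v w. (A x u * A y u) * ((A x v * A y v) * (A x w * A y w)))))"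
    by (simp only: av3_av_swap)
  then show ?thesis
    unfolding av3_prod cod_def[symmetric] by (simp only: K23_def av2_def)
qed

text \<open>Both sides count closed walks of length 4 through \<open>u\<close>: by the two
  neighbours of \<open>u\<close> used, or by the vertex opposite to \<open>u\<close>.\<close>

lemma av2_A_A_cod: "av2 (\<lambda>v w. A u v * (A u w * cod v w)) = av (\<lambda>x. cod u x * cod u x)"
proof -
  have "av2 (\<lambda>v w. A u v * (A u w * cod v w)) = av (\<lambda>v. A u v * nb (nb (A u)) v)"
    unfolding av2_def avg_mult_left av_cod[symmetric] by (simp only: mult.commute)
  also have "\<dots> = av (\<lambda>x. cod u x * cod u x)"
    unfolding nb_adjoint[of "A u"] cod_eq_nb[symmetric] by (simp only: cod_sym)
  finally show ?thesis .
qed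

lemma cod3_sym: "cod3 u v w = cod3 u w v" "cod3 u v w = cod3 w v u" "cod3 u v w = cod3 v u w"
  unfolding cod3_def by (simp_all only: mult_ac)

lemma av3_cod3_vals: "av3 (\<lambda>u v w. cod3 u v w) = S3"
  "av3 (\<lambda>u v w. cod3 u v w * deg u) = F3" "av3 (\<lambda>u v w. cod3 u v w * deg v) = F3" "av3 (\<lambda>u v w. cod3 u v w * deg w) = F3"
  "av3 (\<lambda>u v w. cod3 u v w * cod u v) = C4'" "av3 (\<lambda>u v w. cod3 u v w * cod u w) = C4'"
  "av3 (\<lambda>u v w. cod3 u v w * cod v w) = C4'"
proof -
  have AA: "av2 (\<lambda>u v. A x u * A x v) = deg x * deg x" for x
    unfolding av2_prod deg_def ..
  show "av3 (\<lambda>u v w. cod3 u v w) = S3"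
    using av3_cod3[of "\<lambda>_ _. 1" "\<lambda>_. 1"] by (simp add: AA nb_one S3_def)
  show 1: "av3 (\<lambda>u v w. cod3 u v w * deg w) = F3"
    using av3_cod3[of "\<lambda>_ _. 1" deg] by (simp add: AA F3_def deg2_def mult_ac)
  show 2: "av3 (\<lambda>u v w. cod3 u v w * deg v) = F3"
    using 1 av3_swap23[of "\<lambda>u v w. cod3 u v w * deg w"] by (simp add: cod3_sym(1))
  show "av3 (\<lambda>u v w. cod3 u v w * deg u) = F3"
    using 2 av3_swap12[of "\<lambda>u v w. cod3 u v w * deg v"] by (simp add: cod3_sym(3))
  show 3: "av3 (\<lambda>u v w. cod3 u v w * cod u v) = C4'"
    using av3_cod3[of cod "\<lambda>_. 1"] by (simp add: av2_A_A_cod nb_one C4'_def av2_def avg_mult_left)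
  show 4: "av3 (\<lambda>u v w. cod3 u v w * cod u w) = C4'"
    using 3 av3_swap23[of "\<lambda>u v w. cod3 u v w * cod u v"] by (simp add: cod3_sym(1))
  show "av3 (\<lambda>u v w. cod3 u v w * cod v w) = C4'"
    using 4 av3_swap12[of "\<lambda>u v w. cod3 u v w * cod u w"] by (simp add: cod3_sym(3))
qed

section \<open>Evaluations for independent triples\<close>

lemma av_cod': "av (\<lambda>v. cod u v) = deg2 u" "av (\<lambda>u. cod u v) = deg2 v"
proof -
  show 1: "av (\<lambda>v. cod u v) = deg2 u" for u
    using av_cod[of u "\<lambda>_. 1"] by (simp add: nb_one deg2_def)
  show "av (\<lambda>u. cod u v) = deg2 v"
    using 1[of v] by (simp only: cod_sym)
qed

lemma av_A: "av (\<lambda>v. A u v) = deg u" "av (\<lambda>u. A u v) = deg v"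
  unfolding deg_def A_sym[of _ v] by (rule refl)+

lemma av3_one: "av3 (\<lambda>u v w. f u) = av f" "av3 (\<lambda>u v w. f v) = av f" "av3 (\<lambda>u v w. f w) = av f"
  by (simp_all add: av3_def)

lemma av3_two: "av3 (\<lambda>u v w. f u * g v) = av f * av g" "av3 (\<lambda>u v w. f u * g w) = av f * av g"
  "av3 (\<lambda>u v w. f v * g w) = av f * av g"
  by (simp_all add: av3_def av_simps)

lemma av3_split: "av3 (\<lambda>u v w. f u * g v w) = av f * av2 g" "av3 (\<lambda>u v w. f v * g u w) = av f * av2 g"
  "av3 (\<lambda>u v w. f w * g u v) = av f * av2 g"
  by (simp_all add: av3_def av2_def av_simps)

lemma av3_vals_1:
  "av3 (\<lambda>u v w. (deg u + deg v + deg w) * (deg u + deg v + deg w)) = 3 * S2 + 6 * (D * D)"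
  "av3 (\<lambda>u v w. (deg u + deg v + deg w) * (cod u v + cod u w + cod v w)) = 6 * P3 + 3 * (D * S2)"
  "av3 (\<lambda>u v w. (cod u v + cod u w + cod v w) * (cod u v + cod u w + cod v w)) = 3 * C4 + 6 * P4"
  "av3 (\<lambda>u v w. deg u + deg v + deg w) = 3 * D"
  "av3 (\<lambda>u v w. cod u v + cod u w + cod v w) = 3 * S2"
proof -
  have "(deg u + deg v + deg w) * (deg u + deg v + deg w) =
     deg u * deg u + deg v * deg v + deg w * deg w + 2 * (deg u * deg v) + 2 * (deg u * deg w) + 2 * (deg v * deg w)" for u v w
    by (simp add: algebra_simps)
  then show "av3 (\<lambda>u v w. (deg u + deg v + deg w) * (deg u + deg v + deg w)) = 3 * S2 + 6 * (D * D)"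
    by (simp only: av3_lin av3_one av3_two D_def[symmetric] S2_def[symmetric])
  have e: "(deg u + deg v + deg w) * (cod u v + cod u w + cod v w) =
      cod u v * deg u + cod u v * deg v + cod u w * deg u + cod u w * deg w + cod v w * deg v + cod v w * deg w
      + deg u * cod v w + deg v * cod u w + deg w * cod u v" for u v w
    by (simp add: algebra_simps)
  have "av3 (\<lambda>u v w. cod u v * deg u) = P3" "av3 (\<lambda>u v w. cod u v * deg v) = P3"
    "av3 (\<lambda>u v w. cod u w * deg u) = P3" "av3 (\<lambda>u v w. cod u w * deg w) = P3"
    "av3 (\<lambda>u v w. cod v w * deg v) = P3" "av3 (\<lambda>u v w. cod v w * deg w) = P3"
    by (simp_all only: av3_pair av2_cod_deg)
  moreover have "av3 (\<lambda>u v w. deg u * cod v w) = D * S2" "av3 (\<lambda>u v w. deg v * cod u w) = D * S2"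
    "av3 (\<lambda>u v w. deg w * cod u v) = D * S2"
    by (simp_all only: av3_split av2_cod_deg D_def)
  ultimately show "av3 (\<lambda>u v w. (deg u + deg v + deg w) * (cod u v + cod u w + cod v w)) = 6 * P3 + 3 * (D * S2)"
    unfolding e av3_lin by simp
  have e: "(cod u v + cod u w + cod v w) * (cod u v + cod u w + cod v w) = cod u v * cod u v + cod u w * cod u w + cod v w * cod v w
     + 2 * (cod u v * cod u w) + 2 * (cod u v * cod v w) + 2 * (cod u w * cod v w)" for u v w
    by (simp add: algebra_simps)
  have "av3 (\<lambda>u v w. cod u v * cod u v) = C4" "av3 (\<lambda>u v w. cod u w * cod u w) = C4" "av3 (\<lambda>u v w. cod v w * cod v w) = C4"
    unfolding C4_def by (simp_all only: av3_pair)
  moreover have "av3 (\<lambda>u v w. cod u v * cod u w) = P4" "av3 (\<lambda>u v w. cod u v * cod v w) = P4" "av3 (\<lambda>u v w. cod u w * cod v w) = P4"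
    unfolding av3_share av_cod' P4_def by (rule refl)+
  ultimately show "av3 (\<lambda>u v w. (cod u v + cod u w + cod v w) * (cod u v + cod u w + cod v w)) = 3 * C4 + 6 * P4"
    unfolding e av3_lin by simp
  show "av3 (\<lambda>u v w. deg u + deg v + deg w) = 3 * D"
    unfolding av3_lin av3_one D_def by simp
  show "av3 (\<lambda>u v w. cod u v + cod u w + cod v w) = 3 * S2"
    unfolding av3_lin av3_pair av2_cod_deg by simp
qed

lemma nb_const: "nb (\<lambda>x. c) u = deg u * c"
  by (simp add: nb_def deg_def avg_mult_right)

lemma av3_A_sym: "av3 (\<lambda>u v w. A u v * f v u w) = av3 (\<lambda>u v w. A u v * f u v w)"
  using av3_swap12[of "\<lambda>u v w. A u v * f u v w"] by (simp add: A_sym)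

lemma av3_A_vals:
  "av3 (\<lambda>u v w. A u v) = D" "av3 (\<lambda>u v w. A u v * deg u) = S2" "av3 (\<lambda>u v w. A u v * deg w) = D * D"
  "av3 (\<lambda>u v w. A u v * cod u w) = P3" "av3 (\<lambda>u v w. A u v * (deg u * deg u)) = S3"
  "av3 (\<lambda>u v w. A u v * (deg w * deg w)) = D * S2" "av3 (\<lambda>u v w. A u v * (deg u * deg v)) = P3"
  "av3 (\<lambda>u v w. A u v * (deg u * deg w)) = D * S2" "av3 (\<lambda>u v w. A u v * (deg u * cod u w)) = F3"
  "av3 (\<lambda>u v w. A u v * (deg v * cod u w)) = P4" "av3 (\<lambda>u v w. A u v * (deg w * cod u w)) = P4"
  "av3 (\<lambda>u v w. A u v * (cod u w * cod u w)) = C4'"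
proof -
  show "av3 (\<lambda>u v w. A u v) = D" "av3 (\<lambda>u v w. A u v * deg w) = D * D"
    "av3 (\<lambda>u v w. A u v * (deg w * deg w)) = D * S2"
    by (simp_all add: av3_def av_simps deg_def[symmetric] D_def S2_def mult.commute)
  show "av3 (\<lambda>u v w. A u v * deg u) = S2" "av3 (\<lambda>u v w. A u v * (deg u * deg u)) = S3"
    "av3 (\<lambda>u v w. A u v * (deg u * deg v)) = P3"
    by (simp_all only: av3_pair av2_A_deg)
  show "av3 (\<lambda>u v w. A u v * (deg u * deg w)) = D * S2"
    unfolding av3_A_left av2_deg ..
  show "av3 (\<lambda>u v w. A u v * cod u w) = P3" "av3 (\<lambda>u v w. A u v * (deg w * cod u w)) = P4"
    "av3 (\<lambda>u v w. A u v * (deg u * cod u w)) = F3" "av3 (\<lambda>u v w. A u v * (cod u w * cod u w)) = C4'"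
    unfolding av3_A_left C4'_def using av2_cod_deg(2,4,5) by (simp_all add: mult_ac)
  show "av3 (\<lambda>u v w. A u v * (deg v * cod u w)) = P4"
    using av3_share(1)[of "\<lambda>u v. A u v * deg v" cod]
    by (simp add: av_cod' nb_def[symmetric] deg2_def[symmetric] P4_def mult.assoc)
qed

lemma av3_A_A_vals:
  "av3 (\<lambda>u v w. A u v * A u w) = S2" "av3 (\<lambda>u v w. A u v * (A u w * deg u)) = S3"
  "av3 (\<lambda>u v w. A u v * (A u w * deg v)) = P3" "av3 (\<lambda>u v w. A u v * (A u w * deg w)) = P3"
  "av3 (\<lambda>u v w. A u v * (A u w * cod v w)) = C4"
  "av3 (\<lambda>u v w. A u v * (A u w * (deg u * deg u))) = S4"
  "av3 (\<lambda>u v w. A u v * (A u w * (deg v * deg v))) = F3" "av3 (\<lambda>u v w. A u v * (A u w * (deg w * deg w))) = F3"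
  "av3 (\<lambda>u v w. A u v * (A u w * (deg u * deg v))) = F3" "av3 (\<lambda>u v w. A u v * (A u w * (deg u * deg w))) = F3"
  "av3 (\<lambda>u v w. A u v * (A u w * (deg v * deg w))) = P4"
  "av3 (\<lambda>u v w. A u v * (A u w * (deg u * cod v w))) = C4'"
  "av3 (\<lambda>u v w. A u v * (A u w * (deg v * cod v w))) = C4'" "av3 (\<lambda>u v w. A u v * (A u w * (deg w * cod v w))) = C4'"
  "av3 (\<lambda>u v w. A u v * (A u w * (cod v w * cod v w))) = K23"
proof -
  have one: "av2 (\<lambda>v w. cod v w * 1) = S2" using av2_cod_deg(1) by simp
  show "av3 (\<lambda>u v w. A u v * A u w) = S2"
    using av3_A_A[of "\<lambda>_ _. 1"] one by simp
  show "av3 (\<lambda>u v w. A u v * (A u w * deg v)) = P3" "av3 (\<lambda>u v w. A u v * (A u w * deg w)) = P3"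
    "av3 (\<lambda>u v w. A u v * (A u w * cod v w)) = C4"
    "av3 (\<lambda>u v w. A u v * (A u w * (deg v * deg v))) = F3" "av3 (\<lambda>u v w. A u v * (A u w * (deg w * deg w))) = F3"
    "av3 (\<lambda>u v w. A u v * (A u w * (deg v * deg w))) = P4"
    "av3 (\<lambda>u v w. A u v * (A u w * (cod v w * cod v w))) = K23"
    unfolding av3_A_A av2_cod_deg C4_def K23_def by (rule refl)+
  show "av3 (\<lambda>u v w. A u v * (A u w * (deg v * cod v w))) = C4'" "av3 (\<lambda>u v w. A u v * (A u w * (deg w * cod v w))) = C4'"
    unfolding av3_A_A using av2_cod_deg(7,8) by (simp_all add: mult_ac)
  have "av3 (\<lambda>u v w. A u v * (A u w * (deg u * cod v w))) = av (\<lambda>u. deg u * av2 (\<lambda>v w. A u v * (A u w * cod v w)))"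
    unfolding av3_def av2_def avg_mult_left[symmetric] by (simp only: mult_ac)
  then show "av3 (\<lambda>u v w. A u v * (A u w * (deg u * cod v w))) = C4'"
    unfolding av2_A_A_cod C4'_def av2_def avg_mult_left .
  show "av3 (\<lambda>u v w. A u v * (A u w * deg u)) = S3" "av3 (\<lambda>u v w. A u v * (A u w * (deg u * deg u))) = S4"
    using av3_share(1)[of "\<lambda>u v. A u v * deg u" A] av3_share(1)[of "\<lambda>u v. A u v * (deg u * deg u)" A]
    by (simp_all add: avg_mult_right av_A S3_def S4_def mult_ac)
  show "av3 (\<lambda>u v w. A u v * (A u w * (deg u * deg v))) = F3" 
    using av3_share(1)[of "\<lambda>u v. A u v * deg v" "\<lambda>u w. deg u * A u w"]
    by (simp add: avg_mult_left av_A nb_def[symmetric] nb_const deg2_def[symmetric] F3_def mult_ac)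
  show "av3 (\<lambda>u v w. A u v * (A u w * (deg u * deg w))) = F3"
    using av3_share(1)[of "\<lambda>u w. deg u * A u w" "\<lambda>u v. A u v * deg v"]
    by (simp add: avg_mult_left av_A nb_def[symmetric] nb_const deg2_def[symmetric] F3_def mult_ac)
qed

text \<open>Relabelling the vertices: for a symmetric \<open>G\<close> only one position of an edge
  and one position of a path of length 2 need evaluation.\<close>

lemma av3_sym_weights:
  assumes "\<And>u v w. G v u w = G u v w" "\<And>u v w. G u w v = G u v w"
  shows "av3 (\<lambda>u v w. A u w * G u v w) = av3 (\<lambda>u v w. A u v * G u v w)"
    "av3 (\<lambda>u v w. A v w * G u v w) = av3 (\<lambda>u v w. A u v * G u v w)"
    "av3 (\<lambda>u v w. A u v * (A v w * G u v w)) = av3 (\<lambda>u v w. A u v * (A u w * G u v w))"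
    "av3 (\<lambda>u v w. A u w * (A v w * G u v w)) = av3 (\<lambda>u v w. A u v * (A u w * G u v w))"
proof -
  show 1: "av3 (\<lambda>u v w. A u w * G u v w) = av3 (\<lambda>u v w. A u v * G u v w)"
    using av3_swap23[of "\<lambda>u v w. A u v * G u v w"] by (simp add: assms(2))
  show "av3 (\<lambda>u v w. A v w * G u v w) = av3 (\<lambda>u v w. A u v * G u v w)"
    using 1 av3_swap12[of "\<lambda>u v w. A u w * G u v w"] by (simp add: assms(1))
  show 2: "av3 (\<lambda>u v w. A u v * (A v w * G u v w)) = av3 (\<lambda>u v w. A u v * (A u w * G u v w))"
    using av3_swap12[of "\<lambda>u v w. A u v * (A u w * G u v w)"] by (simp add: assms(1) A_sym)
  show "av3 (\<lambda>u v w. A u w * (A v w * G u v w)) = av3 (\<lambda>u v w. A u v * (A u w * G u v w))"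
    using 2 av3_swap23[of "\<lambda>u v w. A u v * (A v w * G u v w)"] by (simp add: assms(2) A_sym)
qed

text \<open>The \<open>av3\<close> mean, over independent triples, of the square of \<open>a + c *
  (deg u + deg v + deg w) + e * (cod u v + cod u w + cod v w) + f * cod3 u v w\<close>, expanded
  into densities.\<close>

definition independent_form :: "real \<Rightarrow> real \<Rightarrow> real \<Rightarrow> real \<Rightarrow> real" where
  "independent_form a c e f = a\<^sup>2 * (1 - 3 * D + 3 * S2) + 2 * a * c * (3 * D - 6 * S2 - 3 * (D * D) + 3 * S3 + 6 * P3)
     + 2 * a * e * (3 * S2 - 6 * P3 + 3 * C4)
     + c\<^sup>2 * (3 * S2 + 6 * (D * D) - 6 * S3 - 15 * (D * S2) - 6 * P3 + 3 * S4 + 18 * F3 + 6 * P4)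
     + 2 * c * e * (6 * P3 + 3 * (D * S2) - 6 * F3 - 12 * P4 + 9 * C4')
     + e\<^sup>2 * (3 * C4 + 6 * P4 - 6 * C4' - 6 * C5 + 3 * K23)
     + 2 * a * f * S3 + 6 * c * f * F3 + 6 * e * f * C4' + f\<^sup>2 * K23"

lemma independent_form_nonneg: "0 \<le> independent_form a c e f"
proof -
  let ?d = "\<lambda>u v w. deg u + deg v + deg w" and ?k = "\<lambda>u v w. cod u v + cod u w + cod v w"
  define g where "g u v w = a + c * ?d u v w + e * ?k u v w" for u v w
  define G where "G u v w = (g u v w)\<^sup>2" for u v w
  have sym: "G v u w = G u v w" "G u w v = G u v w" for u v w
    unfolding G_def g_def by (simp_all only: cod_sym ac_simps)
  let ?I = "\<lambda>u v w. (1 - A u v) * ((1 - A u w) * (1 - A v w)) * (g u v w + f * cod3 u v w)\<^sup>2"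
  have "0 \<le> av3 ?I"
    using A_le_1 by (intro av3_nonneg mult_nonneg_nonneg) auto
  \<comment> \<open>Inclusion-exclusion over the three possible edges, without a triangle term.
    Terms containing \<open>cod3\<close> keep weight 1, since \<open>cod3\<close> vanishes as soon
    as one of the edges is present.\<close>
  also have "?I = (\<lambda>u v w. G u v w - A u v * G u v w - A u w * G u v w - A v w * G u v w
      + A u v * (A u w * G u v w) + A u v * (A v w * G u v w) + A u w * (A v w * G u v w)
      + 2 * f * (cod3 u v w * g u v w) + f\<^sup>2 * (cod3 u v w * cod3 u v w))"
  proof (intro ext)
    fix u v w
    have t: "A u v * (A u w * A v w) = 0" using A_tri[of u v w] by (simp add: mult.commute)
    have "cod3 u v w = 0 \<or> A u v = 0 \<and> A u w = 0 \<and> A v w = 0"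
      using A_cod3(1)[of u v w] A_cod3(2)[of u w v] A_cod3(3)[of v w u] by (simp del: A_cod3) blast
    then show "?I u v w = G u v w - A u v * G u v w - A u w * G u v w - A v w * G u v w
      + A u v * (A u w * G u v w) + A u v * (A v w * G u v w) + A u w * (A v w * G u v w)
      + 2 * f * (cod3 u v w * g u v w) + f\<^sup>2 * (cod3 u v w * cod3 u v w)"
      using t by (auto simp: G_def power2_eq_square algebra_simps)
  qed
  also have "av3 \<dots> = av3 G - 3 * av3 (\<lambda>u v w. A u v * G u v w) + 3 * av3 (\<lambda>u v w. A u v * (A u w * G u v w))
      + 2 * f * av3 (\<lambda>u v w. cod3 u v w * g u v w) + f\<^sup>2 * K23"
    unfolding av3_lin av3_sym_weights[of G, OF sym] av3_cod3_cod3 by simp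
  also have "av3 G = a\<^sup>2 + 2 * a * c * (3 * D) + 2 * a * e * (3 * S2) + c\<^sup>2 * (3 * S2 + 6 * (D * D))
      + 2 * c * e * (6 * P3 + 3 * (D * S2)) + e\<^sup>2 * (3 * C4 + 6 * P4)"
  proof -
    have "G = (\<lambda>u v w. a\<^sup>2 + 2 * a * c * ?d u v w + 2 * a * e * ?k u v w + c\<^sup>2 * (?d u v w * ?d u v w)
        + 2 * c * e * (?d u v w * ?k u v w) + e\<^sup>2 * (?k u v w * ?k u v w))"
      unfolding G_def g_def power2_eq_square by (intro ext) (simp only: algebra_simps)
    then have "av3 G = av3 (\<lambda>u v w. a\<^sup>2) + 2 * a * c * av3 ?d + 2 * a * e * av3 ?k + c\<^sup>2 * av3 (\<lambda>u v w. ?d u v w * ?d u v w)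
        + 2 * c * e * av3 (\<lambda>u v w. ?d u v w * ?k u v w) + e\<^sup>2 * av3 (\<lambda>u v w. ?k u v w * ?k u v w)"
      by (simp only: av3_lin)
    then show ?thesis unfolding av3_vals_1 by (simp add: av3_def)
  qed
  also have "av3 (\<lambda>u v w. A u v * G u v w) = a\<^sup>2 * D + 2 * a * c * (2 * S2 + D * D) + 4 * a * e * P3
      + c\<^sup>2 * (2 * S3 + 5 * (D * S2) + 2 * P3) + 4 * c * e * (F3 + 2 * P4) + e\<^sup>2 * (2 * C4' + 2 * C5)"
  proof -
    \<comment> \<open>\<open>H\<close> collects the monomials symmetric in \<open>u\<close> and
      \<open>v\<close>; \<open>J\<close> takes one monomial from each pair exchanged by swapping
      them, so it is evaluated only once.\<close>
    define H where "H u v w = a\<^sup>2 * A u v + 2 * a * c * (A u v * deg w) + c\<^sup>2 * (A u v * (deg w * deg w))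
        + 2 * c\<^sup>2 * (A u v * (deg u * deg v)) + 2 * e\<^sup>2 * (A u v * (cod u w * cod v w))" for u v w
    define J where "J u v w = 2 * a * c * deg u + 2 * a * e * cod u w + c\<^sup>2 * (deg u * deg u)
        + 2 * c\<^sup>2 * (deg u * deg w) + 2 * c * e * (deg u * cod u w) + 2 * c * e * (deg v * cod u w)
        + 2 * c * e * (deg w * cod u w) + e\<^sup>2 * (cod u w * cod u w)" for u v w
    have "A u v * G u v w = H u v w + (A u v * J u v w + A u v * J v u w)" for u v w
    proof -
      have "A u v = 0 \<or> cod u v = 0" using A_cod(1)[of u v] by (simp del: A_cod)
      then show ?thesis
        by (auto simp: G_def g_def H_def J_def power2_eq_square algebra_simps)
    qed
    then have "av3 (\<lambda>u v w. A u v * G u v w) = av3 H + 2 * av3 (\<lambda>u v w. A u v * J u v w)"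
      by (simp only: av3_lin(1) av3_A_sym[of J])
    also have "av3 H = a\<^sup>2 * D + 2 * a * c * (D * D) + c\<^sup>2 * (D * S2) + 2 * c\<^sup>2 * P3 + 2 * e\<^sup>2 * C5"
      unfolding H_def[abs_def] av3_lin av3_A_vals av3_A_cod_cod ..
    also have "av3 (\<lambda>u v w. A u v * J u v w) = 2 * a * c * S2 + 2 * a * e * P3 + c\<^sup>2 * S3 + 2 * c\<^sup>2 * (D * S2)
        + 2 * c * e * F3 + 2 * c * e * P4 + 2 * c * e * P4 + e\<^sup>2 * C4'"
    proof -
      have "A u v * J u v w = 2 * a * c * (A u v * deg u) + 2 * a * e * (A u v * cod u w) + c\<^sup>2 * (A u v * (deg u * deg u))
          + 2 * c\<^sup>2 * (A u v * (deg u * deg w)) + 2 * c * e * (A u v * (deg u * cod u w)) + 2 * c * e * (A u v * (deg v * cod u w))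
          + 2 * c * e * (A u v * (deg w * cod u w)) + e\<^sup>2 * (A u v * (cod u w * cod u w))" for u v w
        by (simp add: J_def algebra_simps)
      then show ?thesis by (simp only: av3_lin av3_A_vals)
    qed
    finally show ?thesis by (simp add: algebra_simps)
  qed
  also have "av3 (\<lambda>u v w. A u v * (A u w * G u v w)) = a\<^sup>2 * S2 + 2 * a * c * (S3 + 2 * P3) + 2 * a * e * C4
      + c\<^sup>2 * (S4 + 6 * F3 + 2 * P4) + 6 * c * e * C4' + e\<^sup>2 * K23"
  proof -
    define B where "B x u v w = A u v * (A u w * x)" for x u v w
    have "A u v * (A u w * G u v w) = a\<^sup>2 * (A u v * A u w) + 2 * a * c * B (deg u) u v w + 2 * a * c * B (deg v) u v w
        + 2 * a * c * B (deg w) u v w + 2 * a * e * B (cod v w) u v w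
        + c\<^sup>2 * B (deg u * deg u) u v w + c\<^sup>2 * B (deg v * deg v) u v w + c\<^sup>2 * B (deg w * deg w) u v w
        + 2 * c\<^sup>2 * B (deg u * deg v) u v w + 2 * c\<^sup>2 * B (deg u * deg w) u v w + 2 * c\<^sup>2 * B (deg v * deg w) u v w
        + 2 * c * e * B (deg u * cod v w) u v w + 2 * c * e * B (deg v * cod v w) u v w + 2 * c * e * B (deg w * cod v w) u v w
        + e\<^sup>2 * B (cod v w * cod v w) u v w" for u v w
    proof -
      have "A u v = 0 \<or> cod u v = 0" "A u w = 0 \<or> cod u w = 0"
        using A_cod(1)[of u v] A_cod(1)[of u w] by (simp_all del: A_cod)
      then show ?thesis
        by (auto simp: G_def g_def B_def power2_eq_square algebra_simps)
    qed
    then show ?thesis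
      unfolding B_def by (simp only: av3_lin av3_A_A_vals) (simp add: algebra_simps)
  qed
  also have "av3 (\<lambda>u v w. cod3 u v w * g u v w) = a * S3 + 3 * c * F3 + 3 * e * C4'"
  proof -
    have "cod3 u v w * g u v w = a * cod3 u v w + c * (cod3 u v w * deg u) + c * (cod3 u v w * deg v) + c * (cod3 u v w * deg w)
       + e * (cod3 u v w * cod u v) + e * (cod3 u v w * cod u w) + e * (cod3 u v w * cod v w)" for u v w
      by (simp add: g_def algebra_simps)
    then show ?thesis by (simp only: av3_lin av3_cod3_vals)
  qed
  finally show ?thesis by (simp add: independent_form_def algebra_simps)
qed

end

subsection \<open>Inequalities from halves\<close>

text \<open>The situation to be refuted: every half has density at least \<open>b\<close>.\<close>

locale tri_free_halves = tri_free +
  fixes b :: real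
  assumes b_pos: "0 < b"
    and half_ge: "(\<And>v. v \<in> V \<Longrightarrow> 0 \<le> f v \<and> f v \<le> 1) \<Longrightarrow> av f = 1/2 \<Longrightarrow> b \<le> Q f"
begin

lemma bil_one: "bil (\<lambda>x. 1) (\<lambda>x. 1) = D"
  by (simp add: bil_def D_def nb_one)

lemma D_ge: "8 * b \<le> D"
proof -
  have "b \<le> Q (\<lambda>x. 1/2 * 1)" by (rule half_ge) auto
  also have "\<dots> = D / 8" unfolding Q_bil bil_scale_left bil_scale_right bil_one by simp
  finally show ?thesis by simp
qed

lemma scaled_ge:
  assumes "\<And>v. v \<in> V \<Longrightarrow> 0 \<le> f v \<and> f v \<le> 1" and "av f \<ge> 1/2"
  shows "b * (2 * av f)\<^sup>2 \<le> Q f"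
proof -
  let ?c = "1 / (2 * av f)"
  have c: "0 \<le> ?c" "?c \<le> 1" using assms(2) by (auto simp: field_simps)
  have "b \<le> Q (\<lambda>x. ?c * f x)"
  proof (rule half_ge)
    show "av (\<lambda>x. ?c * f x) = 1/2" using assms(2) by (subst avg_mult_left) simp
    fix v assume "v \<in> V"
    then show "0 \<le> ?c * f v \<and> ?c * f v \<le> 1"
      using mult_le_one[OF c(2), of "f v"] mult_nonneg_nonneg[OF c(1), of "f v"] assms(1)[of v] by blast
  qed
  also have "\<dots> = Q f / (2 * av f)\<^sup>2" unfolding Q_bil bil_simps by (simp add: power2_eq_square)
  finally show ?thesis using assms(2) by (simp add: field_simps)
qed

text \<open>Otherwise the indicator of the neighbourhood of \<open>v\<close> scales down to a half
  supported on an independent set, of density 0.\<close>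

lemma deg_less_half:
  assumes "v \<in> V"
  shows "deg v < 1/2"
proof (rule ccontr)
  assume "\<not> ?thesis"
  then have "1/2 \<le> av (A v)" by (simp add: deg_def)
  with scaled_ge[of "A v"] have "b * (2 * av (A v))\<^sup>2 \<le> Q (A v)"
    using A_nonneg A_le_1 by auto
  moreover have "Q (A v) = 0"
    unfolding Q_bil using bil_nbhd_eq_0[of "A v" v "A v"] A_01 by auto
  moreover have "0 < b * (2 * av (A v))\<^sup>2"
    using b_pos \<open>1/2 \<le> av (A v)\<close> by auto
  ultimately show False by simp
qed

text \<open>
The two halves in the proof, \<open>f + t (1 - f)\<close> and \<open>s (1 - f)\<close>, are averaged with weights \<open>s\<close> and \<open>t = 1 - s\<close>.
\<close>

lemma mixed_ge:
  assumes f: "\<And>v. v \<in> V \<Longrightarrow> 0 \<le> f v \<and> f v \<le> 1" and q: "q = 1 - 2 * av f" "0 \<le> q"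
  shows "b * (1 + q)\<^sup>2 \<le> Q f + q * D / 2"
proof -
  let ?g = "\<lambda>x. 1 - f x"
  define t s where "t = q / (1 + q)" and "s = 1 / (1 + q)"
  have ts: "0 \<le> t" "t \<le> 1" "0 \<le> s" "s \<le> 1" "s + t = 1"
    using q(2) by (auto simp: t_def s_def field_simps)
  have "b \<le> Q (\<lambda>x. f x + t * ?g x)"
  proof (rule half_ge)
    show "av (\<lambda>x. f x + t * ?g x) = 1/2"
      unfolding av_simps using q by (simp add: t_def s_def field_simps)
    fix v assume "v \<in> V"
    then have "0 \<le> t * ?g v" "t * ?g v \<le> 1 * ?g v"
      using f[of v] mult_nonneg_nonneg[OF ts(1), of "?g v"] mult_right_mono[OF ts(2), of "?g v"] by auto
    then show "0 \<le> f v + t * ?g v \<and> f v + t * ?g v \<le> 1" using f[of v] \<open>v \<in> V\<close> by auto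
  qed
  then have 1: "b \<le> Q f + t * bil f ?g + t\<^sup>2 * Q ?g"
    unfolding Q_bil bil_add_right bil_add_left bil_scale_right bil_scale_left bil_sym[of ?g f]
    by (simp add: power2_eq_square algebra_simps)
  have "b \<le> Q (\<lambda>x. s * ?g x)"
  proof (rule half_ge)
    show "av (\<lambda>x. s * ?g x) = 1/2"
      unfolding av_simps using q by (simp add: t_def s_def field_simps)
    fix v assume "v \<in> V"
    then show "0 \<le> s * ?g v \<and> s * ?g v \<le> 1" using f[of v] ts
        mult_nonneg_nonneg[OF ts(3), of "?g v"] mult_le_one[OF ts(4), of "?g v"] by auto
  qed
  then have 2: "b \<le> s\<^sup>2 * Q ?g"
    unfolding Q_bil bil_scale_right bil_scale_left by (simp add: power2_eq_square)
  have D: "D = 2 * Q f + 2 * bil f ?g + 2 * Q ?g"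
  proof -
    have "D = bil (\<lambda>x. f x + ?g x) (\<lambda>x. f x + ?g x)" by (simp add: bil_one)
    then show ?thesis
      unfolding bil_add_right bil_add_left bil_sym[of ?g f] Q_bil by simp
  qed
  have "b = s * b + t * b" using ts(5) by (simp add: distrib_right[symmetric])
  also have "\<dots> \<le> s * (Q f + t * bil f ?g + t\<^sup>2 * Q ?g) + t * (s\<^sup>2 * Q ?g)"
    using 1 2 ts by (intro add_mono mult_left_mono)
  also have "\<dots> = s * Q f + s * t * (bil f ?g + (s + t) * Q ?g)"
    by (simp only: power2_eq_square algebra_simps)
  also have "bil f ?g + (s + t) * Q ?g = D / 2 - Q f"
    using D unfolding ts(5) by linarith
  finally have "b * (1 + q)\<^sup>2 \<le> (s * Q f + s * t * (D / 2 - Q f)) * (1 + q)\<^sup>2"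
    by (rule mult_right_mono) simp
  also have "\<dots> = (s * (1 + q)) * ((1 + q) * Q f + (t * (1 + q)) * (D / 2 - Q f))"
    by (simp only: power2_eq_square algebra_simps)
  also have "s * (1 + q) = 1"
    using q(2) by (simp add: s_def)
  also have "t * (1 + q) = q"
    using q(2) by (simp add: t_def)
  finally show ?thesis by (simp add: algebra_simps)
qed

text \<open>
At \<open>q = 0\<close> the lower bounds on \<open>Q f\<close> from \<open>scaled_ge\<close> (for \<open>q < 0\<close>) and \<open>mixed_ge\<close> (for \<open>q \<ge> 0\<close>) meet in a concave kink; the
term \<open>N (q - p)\<^sup>2\<close> lets a single quadratic lie below both, at little cost where \<open>q\<close> is close to \<open>p\<close>.
\<close>

lemma extended_ge:
  assumes f: "\<And>v. v \<in> V \<Longrightarrow> 0 \<le> f v \<and> f v \<le> 1" and q: "q = 1 - 2 * av f"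
    and e: "D / 2 \<le> e" "e - 4 * b \<le> 4 * N * p" "0 \<le> N" "0 \<le> p"
  shows "0 \<le> Q f + q * e - b * (1 + q)\<^sup>2 + N * (q - p)\<^sup>2"
proof (cases "0 \<le> q")
  case True
  have "b * (1 + q)\<^sup>2 \<le> Q f + q * D / 2" using mixed_ge[OF f q True] .
  moreover have "q * (D / 2) \<le> q * e" using True e(1) by (rule mult_left_mono[rotated])
  moreover have "0 \<le> N * (q - p)\<^sup>2" using e(3) by simp
  ultimately show ?thesis by simp
next
  case False
  have "b * (1 - q)\<^sup>2 \<le> Q f" using scaled_ge[OF f] q False by simp
  moreover have "(- q) * (e - 4 * b) \<le> (- q) * (4 * N * p)" using False e(2) by (intro mult_left_mono) auto
  moreover have "N * (q - p)\<^sup>2 = N * (q + p)\<^sup>2 + (- q) * (4 * N * p)" 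
    by (simp add: power2_eq_square algebra_simps)
  moreover have "0 \<le> N * (q + p)\<^sup>2" using e(3) by simp
  ultimately show ?thesis by (simp add: power2_eq_square algebra_simps)
qed

text \<open>The neighbourhoods of \<open>v\<close> and \<open>w\<close> are disjoint and
  independent. The edges between them have measure \<open>walk3 v w\<close> and contribute to
  neither half, while \<open>D / 2\<close> measures all edges.\<close>

lemma edge_ge:
  assumes vw: "v \<in> V" "w \<in> V" "A v w = 1"
  shows "4 * b \<le> D / 2 - walk3 v w"
proof -
  let ?f = "A v" and ?g = "A w"
  let ?r = "\<lambda>x. 1 - ?f x - ?g x"
  define a c where "a = 1/2 - deg v" and "c = 1/2 - deg w"
  have ac: "0 < a" "0 < c" using deg_less_half vw(1,2) by (auto simp: a_def c_def)
  \<comment> \<open>The levels on the remaining vertices that give mean 1/2: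
    \<open>deg v + t * (a + c) = 1/2\<close>, and symmetrically for \<open>s\<close>.\<close>
  define t s where "t = a / (a + c)" and "s = c / (a + c)"
  have ts: "0 \<le> t" "t \<le> 1" "0 \<le> s" "s \<le> 1" "s + t = 1"
    using ac by (auto simp: t_def s_def add_divide_distrib[symmetric])
  have fg: "?f x * ?g x = 0" for x using A_tri[of v w x] vw(3) by auto
  have r01: "0 \<le> ?r x" "?r x \<le> 1" "?f x + ?r x \<le> 1" "?g x + ?r x \<le> 1" for x
    using fg[of x] A_01[of v x] A_01[of w x] by auto
  have f0: "bil ?f ?f = 0" and g0: "bil ?g ?g = 0"
    using bil_nbhd_eq_0[of ?f v ?f] bil_nbhd_eq_0[of ?g w ?g] A_01 by auto
  have avr: "av ?r = a + c"
    by (simp add: avg_diff a_def c_def deg_def)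
  have "b \<le> Q (\<lambda>x. ?f x + t * ?r x)"
  proof (rule half_ge)
    show "av (\<lambda>x. ?f x + t * ?r x) = 1/2"
      unfolding avg_add avg_mult_left avr using ac by (simp add: t_def a_def deg_def)
    fix x
    have "t * ?r x \<le> 1 * ?r x" "0 \<le> t * ?r x" using ts r01[of x] by (intro mult_right_mono mult_nonneg_nonneg; simp)+
    then show "0 \<le> ?f x + t * ?r x \<and> ?f x + t * ?r x \<le> 1"
      using r01[of x] A_nonneg[of v x] by auto
  qed
  then have 1: "b \<le> t * bil ?f ?r + t\<^sup>2 * Q ?r"
    unfolding Q_bil bil_add_right bil_add_left bil_scale_right bil_scale_left bil_sym[of ?r ?f] f0
    by (simp add: power2_eq_square algebra_simps)
  have "b \<le> Q (\<lambda>x. ?g x + s * ?r x)"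
  proof (rule half_ge)
    show "av (\<lambda>x. ?g x + s * ?r x) = 1/2"
      unfolding avg_add avg_mult_left avr using ac by (simp add: s_def c_def deg_def)
    fix x
    have "s * ?r x \<le> 1 * ?r x" "0 \<le> s * ?r x" using ts r01[of x] by (intro mult_right_mono mult_nonneg_nonneg; simp)+
    then show "0 \<le> ?g x + s * ?r x \<and> ?g x + s * ?r x \<le> 1"
      using r01[of x] A_nonneg[of w x] by auto
  qed
  then have 2: "b \<le> s * bil ?g ?r + s\<^sup>2 * Q ?r"
    unfolding Q_bil bil_add_right bil_add_left bil_scale_right bil_scale_left bil_sym[of ?r ?g] g0
    by (simp add: power2_eq_square algebra_simps)
  have D: "D / 2 = bil ?f ?g + bil ?f ?r + bil ?g ?r + Q ?r"
  proof -
    have "D = bil (\<lambda>x. (?f x + ?g x) + ?r x) (\<lambda>x. (?f x + ?g x) + ?r x)" by (simp add: bil_one)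
    then show ?thesis
      unfolding bil_add_right bil_add_left bil_sym[of ?r ?f] bil_sym[of ?r ?g] bil_sym[of ?g ?f] f0 g0 Q_bil
      by simp
  qed
  \<comment> \<open>The weights are crossed, \<open>s\<close> for the half with level
    \<open>t\<close> and conversely, so that every class of edges gets the same factor
    \<open>s * t\<close>, which is at most 1/4.\<close>
  have "b = s * b + t * b" using ts(5) by (simp add: distrib_right[symmetric])
  also have "\<dots> \<le> s * (t * bil ?f ?r + t\<^sup>2 * Q ?r) + t * (s * bil ?g ?r + s\<^sup>2 * Q ?r)"
    using 1 2 ts by (intro add_mono mult_left_mono)
  also have "\<dots> = s * t * (bil ?f ?r + bil ?g ?r + (s + t) * Q ?r)"
    by (simp add: power2_eq_square algebra_simps)
  also have "bil ?f ?r + bil ?g ?r + (s + t) * Q ?r = D / 2 - bil ?f ?g"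
    using D unfolding ts(5) by linarith
  also have "s * t * (D / 2 - bil ?f ?g) \<le> 1/4 * (D / 2 - bil ?f ?g)"
  proof (rule mult_right_mono)
    have "t = 1 - s" using ts(5) by simp
    then show "s * t \<le> 1/4" using zero_le_power2[of "s - 1/2"]
      by (simp only:) (simp add: power2_eq_square algebra_simps)
    have "0 \<le> bil ?f ?r" "0 \<le> bil ?g ?r" "0 \<le> bil ?r ?r"
      using r01 A_nonneg by (auto intro!: bil_nonneg)
    then show "0 \<le> D / 2 - bil ?f ?g" using D by (simp add: Q_bil)
  qed
  finally show ?thesis by (simp add: walk3_bil)
qed

text \<open>This is \<open>extended_ge\<close> for the indicator of the union of the two
  neighbourhoods.\<close>

lemma pair_ge:
  assumes q: "q = 1 - 2 * (deg v + deg w - cod v w)"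
    and e: "D / 2 \<le> e" "e - 4 * b \<le> 4 * N * p" "0 \<le> N" "0 \<le> p"
  shows "0 \<le> walk3 v w + q * e - b * (1 + q)\<^sup>2 + N * (q - p)\<^sup>2"
proof -
  let ?h = "\<lambda>x. A v x * A w x"
  let ?f = "\<lambda>x. A v x + A w x - ?h x"
  have Qf: "Q ?f = walk3 v w"
  proof -
    \<comment> \<open>The intersection \<open>?h\<close> is supported in both neighbourhoods, each
      of which is independent; only the cross term of \<open>A v\<close> and \<open>A w\<close>
      survives.\<close>
    have z: "bil (A v) (A v) = 0" "bil (A v) ?h = 0" "bil ?h (A v) = 0" "bil ?h ?h = 0"
      by (rule bil_nbhd_eq_0[of _ v]; use A_01 in force)+
    have z': "bil (A w) (A w) = 0" "bil (A w) ?h = 0" "bil ?h (A w) = 0"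
      by (rule bil_nbhd_eq_0[of _ w]; use A_01 in force)+
    show ?thesis
      unfolding Q_bil bil_add_right bil_add_left bil_diff_left bil_diff_right walk3_bil z z' bil_sym[of "A w" "A v"]
      by simp
  qed
  have "0 \<le> Q ?f + q * e - b * (1 + q)\<^sup>2 + N * (q - p)\<^sup>2"
  proof (rule extended_ge[OF _ _ e])
    show "0 \<le> ?f x \<and> ?f x \<le> 1" for x using A_01[of v x] A_01[of w x] by auto
    show "q = 1 - 2 * av ?f" by (simp add: q av_simps deg_def cod_def)
  qed
  then show ?thesis by (simp add: Qf)
qed

lemma edge_avg_ge: "0 \<le> D * D / 2 - 4 * b * D - C4"
proof -
  have "0 \<le> av2 (\<lambda>v w. A v w * (D / 2 - 4 * b - walk3 v w))"
  proof (rule av2_nonneg)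
    fix v w assume "v \<in> V" "w \<in> V"
    then show "0 \<le> A v w * (D / 2 - 4 * b - walk3 v w)"
      using A_01[of v w] edge_ge[of v w] by auto
  qed
  also have "(\<lambda>v w. A v w * (D / 2 - 4 * b - walk3 v w)) = (\<lambda>v w. (D / 2 - 4 * b) * A v w - A v w * walk3 v w)"
    by (simp add: fun_eq_iff algebra_simps)
  also have "av2 \<dots> = (D / 2 - 4 * b) * av2 A - C4"
    unfolding av2_lin av2_walk3 ..
  also have "av2 A = D"
    by (simp add: av2_def deg_def[abs_def] D_def)
  finally show ?thesis by (simp add: algebra_simps)
qed

text \<open>With \<open>q = 1 - 2 * s\<close>, where \<open>s = deg v + deg w - cod v w\<close>, the
  bound of \<open>pair_ge\<close> is \<open>walk3 v w\<close> plus a quadratic in \<open>s\<close>.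
  Its coefficients are the three factors here, multiplying the weighted averages of 1,
  \<open>s\<close> and \<open>s\<^sup>2\<close> from \<open>av2_pair\<close>.\<close>

definition pair_form :: "real \<Rightarrow> real \<Rightarrow> real \<Rightarrow> real" where
  "pair_form e N p = (P4 - C4' - C5) + (e - 4 * b + N * (1 - p)\<^sup>2) * (D - 2 * S2)
    - (2 * e - 8 * b + 4 * N * (1 - p)) * (S2 + D * D - 4 * P3 - S3 + C4)
    + 4 * (N - b) * (S3 + 3 * (D * S2) + 5 * C4' - 7 * F3 - 4 * P4 - S4 - K23)"

text \<open>
Averaging \<open>pair_ge\<close> with the weight \<open>deg v - cod v w\<close> over nonadjacent pairs discounts pairs of near twins, for which
\<open>pair_ge\<close> is far from tight.
\<close>

lemma pair_form_nonneg:
  assumes e: "D / 2 \<le> e" "e - 4 * b \<le> 4 * N * p" "0 \<le> N" "0 \<le> p"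
  shows "0 \<le> pair_form e N p"
proof -
  let ?s = "\<lambda>v w. deg v + deg w - cod v w"
  let ?c0 = "e - 4 * b + N * (1 - p)\<^sup>2" and ?c1 = "- (2 * e - 8 * b + 4 * N * (1 - p))" and ?c2 = "4 * (N - b)"
  have "0 \<le> av2 (\<lambda>v w. (1 - A v w) * (deg v - cod v w) * (walk3 v w + ?c0 + ?c1 * ?s v w + ?c2 * (?s v w)\<^sup>2))"
  proof (intro av2_nonneg mult_nonneg_nonneg)
    fix v w
    show "0 \<le> 1 - A v w" "0 \<le> deg v - cod v w" using A_le_1 cod_le_deg by auto
    have "0 \<le> walk3 v w + (1 - 2 * ?s v w) * e - b * (1 + (1 - 2 * ?s v w))\<^sup>2 + N * ((1 - 2 * ?s v w) - p)\<^sup>2"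
      by (rule pair_ge[OF refl e])
    then show "0 \<le> walk3 v w + ?c0 + ?c1 * ?s v w + ?c2 * (?s v w)\<^sup>2"
      by (simp add: power2_eq_square algebra_simps)
  qed
  then show ?thesis unfolding av2_pair pair_form_def by (simp add: algebra_simps)
qed

section \<open>A priori bounds on the densities\<close>

lemma deg2_bounds: "u \<in> V \<Longrightarrow> 0 \<le> deg2 u" "u \<in> V \<Longrightarrow> deg2 u \<le> deg u / 2"
proof -
  show "0 \<le> deg2 u"
    unfolding deg2_def nb_def using A_nonneg deg_nonneg by (intro avg_nonneg mult_nonneg_nonneg)
  have "deg2 u \<le> av (\<lambda>x. A u x * (1/2))"
    unfolding deg2_def nb_def by (intro avg_mono mult_left_mono less_imp_le[OF deg_less_half] A_nonneg)
  also have "\<dots> = deg u * (1/2)" unfolding avg_mult_right deg_def ..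
  finally show "deg2 u \<le> deg u / 2" by simp
qed

lemma cod_bounds: "0 \<le> cod u v" "u \<in> V \<Longrightarrow> cod u v \<le> 1/2"
proof -
  show "0 \<le> cod u v" unfolding cod_def using A_nonneg by (intro avg_nonneg mult_nonneg_nonneg)
  show "cod u v \<le> 1/2" if "u \<in> V" using cod_le_deg[of u v] deg_less_half[OF that] by simp
qed

lemma walk3_bounds: "0 \<le> walk3 u v" "u \<in> V \<Longrightarrow> walk3 u v \<le> 1/4"
proof -
  show "0 \<le> walk3 u v" unfolding walk3_def using A_nonneg cod_bounds by (intro avg_nonneg mult_nonneg_nonneg)
  assume u: "u \<in> V"
  have "walk3 u v \<le> av (\<lambda>x. A u x * (1/2))"
    unfolding walk3_def using A_nonneg cod_bounds by (intro avg_mono mult_left_mono)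
  also have "\<dots> = deg u * (1/2)" unfolding avg_mult_right deg_def ..
  finally show "walk3 u v \<le> 1/4" using deg_less_half[OF u] by simp
qed

text \<open>All degrees are below 1/2, so each further edge of a tree costs a factor of at least 2.
  Bounding everything by multiples of \<open>D\<close> keeps the estimates linear.\<close>

lemma moment_bounds:
  "0 \<le> S2" "S2 \<le> D / 2" "0 \<le> S3" "S3 \<le> D / 4" "0 \<le> S4" "S4 \<le> D / 8" "0 \<le> P3" "P3 \<le> D / 4"
  "0 \<le> F3" "F3 \<le> D / 8" "0 \<le> P4" "P4 \<le> D / 8"
proof -
  note d = deg_nonneg deg_less_half[THEN less_imp_le] deg2_bounds
  have le: "av f \<le> c * av g" if "\<And>v. v \<in> V \<Longrightarrow> f v \<le> c * g v" for f g c
    using avg_mono[OF that] by (simp add: avg_mult_left)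
  show "0 \<le> S2" "0 \<le> S3" "0 \<le> S4" "0 \<le> P3" "0 \<le> F3" "0 \<le> P4"
    unfolding S2_def S3_def S4_def P3_def F3_def P4_def using d by (auto intro!: avg_nonneg mult_nonneg_nonneg)
  have S2: "S2 \<le> 1/2 * D" unfolding S2_def D_def by (intro le mult_right_mono d)
  have S3: "S3 \<le> 1/2 * S2" unfolding S3_def S2_def by (intro le mult_right_mono mult_nonneg_nonneg d)
  have S4: "S4 \<le> 1/2 * S3" unfolding S4_def S3_def by (intro le mult_right_mono mult_nonneg_nonneg d)
  have P3: "P3 \<le> 1/2 * S2" unfolding P3_def S2_def
  proof (intro le)
    fix v assume "v \<in> V"
    then have "deg v * deg2 v \<le> deg v * (deg v / 2)" by (intro mult_left_mono d)
    then show "deg v * deg2 v \<le> 1/2 * (deg v * deg v)" by simp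
  qed
  have F3: "F3 \<le> 1/2 * P3" unfolding F3_def P3_def by (intro le mult_right_mono mult_nonneg_nonneg d)
  have P4: "P4 \<le> 1/2 * P3" unfolding P4_def P3_def
  proof (intro le)
    fix v assume "v \<in> V"
    then have "deg2 v * deg2 v \<le> deg v / 2 * deg2 v" by (intro mult_right_mono d)
    then show "deg2 v * deg2 v \<le> 1/2 * (deg v * deg2 v)" by simp
  qed
  show "S2 \<le> D / 2" "S3 \<le> D / 4" "S4 \<le> D / 8" "P3 \<le> D / 4" "F3 \<le> D / 8" "P4 \<le> D / 8"
    using S2 S3 S4 P3 F3 P4 by linarith+
qed

lemma cycle_bounds:
  "0 \<le> C4" "C4 \<le> D / 4" "0 \<le> C4'" "C4' \<le> D / 8" "0 \<le> K23" "K23 \<le> D / 8" "0 \<le> C5" "C5 \<le> D / 8"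
proof -
  note d = deg_nonneg deg_less_half[THEN less_imp_le] cod_bounds walk3_bounds
  show "0 \<le> C4" "0 \<le> C4'" "0 \<le> K23" "0 \<le> C5"
    unfolding C4_def C4'_def K23_def C5_def using d by (auto intro!: av2_nonneg mult_nonneg_nonneg)
  have le: "av2 f \<le> c * av2 g" if "\<And>u v. u \<in> V \<Longrightarrow> v \<in> V \<Longrightarrow> f u v \<le> c * g u v" for f g c
    using av2_mono[OF that] by (simp add: av2_lin)
  have C4: "C4 \<le> 1/2 * S2" unfolding C4_def av2_cod_deg(1)[symmetric] by (intro le mult_right_mono d)
  have C4': "C4' \<le> 1/2 * C4" unfolding C4'_def C4_def by (intro le mult_right_mono mult_nonneg_nonneg d)
  have K23: "K23 \<le> 1/2 * C4" unfolding K23_def C4_def by (intro le mult_right_mono mult_nonneg_nonneg d)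
  have C5: "C5 \<le> 1/4 * S2" unfolding C5_def av2_cod_deg(1)[symmetric]
  proof (intro le)
    fix u v assume "u \<in> V" "v \<in> V"
    then have "cod u v * walk3 u v \<le> cod u v * (1/4)" by (intro mult_left_mono d)
    then show "cod u v * walk3 u v \<le> 1/4 * cod u v" by simp
  qed
  show "C4 \<le> D / 4" "C4' \<le> D / 8" "K23 \<le> D / 8" "C5 \<le> D / 8"
    using C4 C4' K23 C5 moment_bounds by linarith+
qed

subsection \<open>The contradiction\<close>

text \<open>
The coefficients below come from a numerical solution of the semidefinite program and were rounded. In each case the
displayed sum is a linear combination of the densities which the bounds in \<open>moment_bounds\<close> and \<open>cycle_bounds\<close> show to be
negative; those bounds only absorb the rounding errors.
\<close>

lemmas forms_nonneg = edge_avg_ge independent_form_nonneg edge_form_nonneg vertex_form_nonneg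

lemma density_range_1:
  assumes b: "b = 27/1024" and D: "27/128 \<le> D" "D \<le> (283/1000)"
  shows False
proof -
  \<comment> \<open>In all four ranges \<open>e\<close> is half the upper end, so that
    \<open>D / 2 \<le> e\<close>, and \<open>N = (e - 4 * b) / (4 * p)\<close>, which turns the
    second side condition into an equality.\<close>
  have pair: "0 \<le> pair_form (1415/10000) (1153/16640) (13/100)"
    by (rule pair_form_nonneg) (use D b in simp_all)
  \<comment> \<open>The product of the distances of \<open>D\<close> to the ends of the range is
    nonnegative only within the range. As \<open>D\<close> is fixed for the graph, the first
    coefficient of \<open>vertex_form\<close> may be affine in it.\<close>
  have "0 \<le> (D * D / 2 - 4 * b * D - C4)
      + 2209/10000 * ((D - 27/128) * ((283/1000) - D))
      + 31601/10000 * pair_form (1415/10000) (1153/16640) (13/100)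
      + 63598/10000 * independent_form (-414/10000) (129/1000) (-362/1000) 1
      + 557/10000 * independent_form (791/10000) (-481/1000) 1 (428/1000)
      + 42474/10000 * edge_form (751/10000) (-988/1000) 1
      + 19778/10000 * vertex_form ((313/10000) + (-397/1000) * D) (-67/1000) (307/1000) 1
      + 49/10000 * vertex_form ((59/10000) + 912/1000 * D) (-1) (-66/1000) (315/1000)"
    by (intro add_nonneg_nonneg mult_nonneg_nonneg forms_nonneg pair) (use D in simp_all)
  \<comment> \<open>After expansion \<open>D * D\<close> and \<open>D * S2\<close> are the only
    nonlinear monomials. Bounded in this way by multiples of \<open>D\<close>, they act as further
    variables in a linear problem.\<close>
  moreover have "0 \<le> D * S2" "D * S2 \<le> D * ((283/1000) / 2)" "D * D \<le> D * (283/1000)" "D * 27/128 \<le> D * D"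
    using moment_bounds(1,2) D by (auto intro!: mult_left_mono)
  moreover note D moment_bounds cycle_bounds
  ultimately show False
    unfolding pair_form_def independent_form_def edge_form_def vertex_form_def power2_eq_square unfolding b
    by (simp only: algebra_simps)
qed

lemma density_range_2:
  assumes b: "b = 27/1024" and D: "(283/1000) \<le> D" "D \<le> (306/1000)"
  shows False
proof -
  have pair: "0 \<le> pair_form (153/1000) (117/1280) (13/100)"
    by (rule pair_form_nonneg) (use D b in simp_all)
  have "0 \<le> (D * D / 2 - 4 * b * D - C4)
      + 31/10000 * (D - (283/1000))
      + 5814/10000 * ((D - (283/1000)) * ((306/1000) - D))
      + 44347/10000 * pair_form (153/1000) (117/1280) (13/100)
      + 79746/10000 * independent_form (-582/10000) (129/1000) (-316/1000) 1
      + 46063/10000 * edge_form (237/10000) (-825/1000) 1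
      + 19365/10000 * vertex_form ((903/10000) + (-477/1000) * D) (-286/1000) (537/1000) 1
      + 1953/10000 * vertex_form ((51/10000) + 607/1000 * D) (-778/1000) 1 (-471/1000)
      + 599/10000 * vertex_form ((3749/10000) + (-1) * D) (-183/1000) (158/1000) (-648/1000)"
    by (intro add_nonneg_nonneg mult_nonneg_nonneg forms_nonneg pair) (use D in simp_all)
  moreover have "0 \<le> D * S2" "D * S2 \<le> D * ((306/1000) / 2)" "D * D \<le> D * (306/1000)" "D * (283/1000) \<le> D * D"
    using moment_bounds(1,2) D by (auto intro!: mult_left_mono)
  moreover note D moment_bounds cycle_bounds
  ultimately show False
    unfolding pair_form_def independent_form_def edge_form_def vertex_form_def power2_eq_square unfolding b
    by (simp only: algebra_simps)
qed

lemma density_range_3: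
  assumes b: "b = 27/1024" and D: "(306/1000) \<le> D" "D \<le> (328/1000)"
  shows False
proof -
  have pair: "0 \<le> pair_form (164/1000) (1873/17920) (14/100)"
    by (rule pair_form_nonneg) (use D b in simp_all)
  have "0 \<le> (D * D / 2 - 4 * b * D - C4)
      + 88/10000 * (D - (306/1000))
      + 5571/10000 * ((D - (306/1000)) * ((328/1000) - D))
      + 32131/10000 * pair_form (164/1000) (1873/17920) (14/100)
      + 65175/10000 * independent_form (-643/10000) (143/1000) (-343/1000) 1
      + 39069/10000 * edge_form (404/10000) (-905/1000) 1
      + 18121/10000 * vertex_form ((441/10000) + (-498/1000) * D) (-103/1000) (472/1000) 1
      + 1865/10000 * vertex_form (-(797/10000) + 856/1000 * D) (-865/1000) 1 (-132/1000)
      + 1087/10000 * vertex_form ((4982/10000) + (-1) * D) (-509/1000) (358/1000) (-742/1000)"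
    by (intro add_nonneg_nonneg mult_nonneg_nonneg forms_nonneg pair) (use D in simp_all)
  moreover have "0 \<le> D * S2" "D * S2 \<le> D * ((328/1000) / 2)" "D * D \<le> D * (328/1000)" "D * (306/1000) \<le> D * D"
    using moment_bounds(1,2) D by (auto intro!: mult_left_mono)
  moreover note D moment_bounds cycle_bounds
  ultimately show False
    unfolding pair_form_def independent_form_def edge_form_def vertex_form_def power2_eq_square unfolding b
    by (simp only: algebra_simps)
qed

lemma density_range_4:
  assumes b: "b = 27/1024" and D: "(328/1000) \<le> D" "D \<le> (5/10)"
  shows False
proof -
  have pair: "0 \<le> pair_form (25/100) (925/3584) (14/100)"
    by (rule pair_form_nonneg) (use D b in simp_all)
  have "0 \<le> (D * D / 2 - 4 * b * D - C4)
      + 2/10000 * (D - (328/1000))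
      + 377/1000 * ((D - (328/1000)) * ((5/10) - D))
      + 693/1000 * pair_form (25/100) (925/3584) (14/100)
      + 37491/10000 * independent_form (-524/10000) (181/1000) (-453/1000) 1
      + 438/10000 * independent_form (-9991/10000) (513/1000) (91/100) (267/1000)
      + 33005/10000 * edge_form (-742/10000) 1 (-915/1000)
      + 14289/10000 * vertex_form (-(739/10000) + (-386/1000) * D) (142/1000) (393/1000) 1
      + 288/10000 * vertex_form ((527/10000) + (-839/1000) * D) 1 (-812/1000) (-143/1000)"
    by (intro add_nonneg_nonneg mult_nonneg_nonneg forms_nonneg pair) (use D in simp_all)
  moreover have "0 \<le> D * S2" "D * S2 \<le> D * ((5/10) / 2)" "D * D \<le> D * (5/10)" "D * (328/1000) \<le> D * D"
    using moment_bounds(1,2) D by (auto intro!: mult_left_mono)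
  moreover note D moment_bounds cycle_bounds
  ultimately show False
    unfolding pair_form_def independent_form_def edge_form_def vertex_form_def power2_eq_square unfolding b
    by (simp only: algebra_simps)
qed

lemma b_noteq: "b \<noteq> 27/1024"
proof
  assume b: "b = 27/1024"
  have "D \<le> av (\<lambda>v. 1/2)"
    unfolding D_def by (intro avg_mono less_imp_le[OF deg_less_half])
  then have "D \<le> 1/2" by simp
  \<comment> \<open>The four ranges cover everything from \<open>8 * b = 27/128\<close>, the bound
    of \<open>D_ge\<close>, up to 1/2.\<close>
  then show False
    using D_ge density_range_1[OF b] density_range_2[OF b] density_range_3[OF b] density_range_4[OF b] b by fastforce
qed

end

section \<open>Application to graphs\<close>

theorem theorem3p2:
  fixes V :: "'a set" and E :: "'a set set"
  assumes "simple_graph V E" and "V \<noteq> {}" and "triangle_free E"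
  shows "beta V E \<le> 27 / 1024"
proof (rule ccontr)
  assume *: "\<not> ?thesis"
  interpret tri_free V "adj E"
  proof
    show "finite V" using assms(1) by (simp add: simple_graph_def)
    show "adj E u v * (adj E v w * adj E u w) = 0" for u v w
      using assms(3) by (auto simp: adj_def triangle_free_def)
  qed (use assms(2) in \<open>auto simp: adj_def insert_commute\<close>)
  \<comment> \<open>If the claim fails, every function of mean 1/2 with values in
    \<open>{0..1}\<close> on \<open>V\<close> has density at least
    \<open>beta V E > 27/1024\<close>.\<close>
  interpret tri_free_halves V "adj E" "27/1024"
  proof
    fix f assume "\<And>v. v \<in> V \<Longrightarrow> 0 \<le> f v \<and> f v \<le> 1" "avg V f = 1/2"
    from beta_le_half[OF assms(1,2) this] * show "27/1024 \<le> Q f"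
      by (simp add: Q_def nb_def)
  qed simp
  show False using b_noteq by simp
qed

end
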